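(* Let $X$ and $Y$ be two real Banach spaces and let $(x_n)_{n\in\mathbb N}\subseteq S_X$ and $(y_n)_{n\in\mathbb N}\subseteq S_Y$ be sequences such that $\left\|\sum_{n=1}^\infty\frac1{2^n}x_n\otimes y_n\right\|=1$ in $X\widehat{\otimes}_\pi Y$ (this condition is equivalent to the existence of a norm-one bilinear mapping $V\in\mathcal B(X\times Y)$ such that $V(x_n,y_n)=1$ for every $n\in\mathbb N$). The following are equivalent: (1) For every sequence $(\lambda_n)_{n\in\mathbb N}$ in $(0,1]$ such that $\sum_{n=1}^\infty\lambda_n=1$, the element $\sum_{n=1}^\infty\lambda_n x_n\otimes y_n$ is an SSD point of $S_{X\widehat{\otimes}_\pi Y}$. (2) For every $\varepsilon>0$ there exist $k_\varepsilon\in\mathbb N$ and $\eta(\varepsilon)>0$ such that if $B\in\mathcal B(X\times Y)$ satisfies $\|B\|\leq 1$ and $B(x_n,y_n)>1-\eta(\varepsilon)$ for every $1\leq n\leq k_\varepsilon$, then there exists $\tilde B\in\mathcal B(X\times Y)$ with $\|\tilde B\|=1$ such that $\|B-\tilde B\|<\varepsilon$ and $\tilde B(x_n,y_n)=1$ for every $n\in\mathbb N$.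
   Context: All Banach spaces are real. $B_X$ and $S_X$ denote the closed unit ball and unit sphere of $X$. $\mathcal B(X\times Y)$ is the Banach space of bounded bilinear maps $X\times Y\to\mathbb R$ with norm $\|B\|=\sup\{|B(x,y)|:x\in B_X,y\in B_Y\}$. SSD point: $x\in S_X$ is an SSD point (the norm of $X$ is strongly subdifferentiable at $x$) if the one-sided limit $\lim_{t\to 0^+}\frac{\|x+th\|-1}{t}$ exists uniformly in $h\in S_X$. Projective tensor product: $X\widehat{\otimes}_\pi Y$ is the completion of the algebraic tensor product $X\otimes Y$ under the norm $\|z\|_\pi=\inf\{\sum_{n=1}^k\|x_n\|\|y_n\|: z=\sum_{n=1}^k x_n\otimes y_n\}$. Its dual is isometrically identified with $\mathcal B(X\times Y)$ via $B(x\otimes y)=B(x,y)$. *)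

theory Defs
  imports "HOL-Analysis.Analysis" "HOL-Analysis.Finite_Function_Topology"
begin

section \<open>Strong subdifferentiability and bilinear forms\<close>

definition SSD_point :: "'a::real_normed_vector \<Rightarrow> bool" where
  "SSD_point x \<longleftrightarrow> norm x = 1 \<and>
     (\<exists>l. uniform_limit (sphere 0 1) (\<lambda>t h. (norm (x + t *\<^sub>R h) - 1) / t) l (at_right 0))"

text \<open>The supremum is the norm when \<open>B\<close> satisfies \<^const>\<open>bounded_bilinear\<close>; for other \<open>B\<close> the
  value is meaningless.\<close>

definition bilin_norm :: "('a::real_normed_vector \<Rightarrow> 'b::real_normed_vector \<Rightarrow> real) \<Rightarrow> real" where
  "bilin_norm B = (SUP (x, y) \<in> cball 0 1 \<times> cball 0 1. \<bar>B x y\<bar>)"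

section \<open>The algebraic tensor product\<close>

text \<open>The free vector space on \<open>'a \<times> 'b\<close> modulo the span of the bilinearity relations.\<close>

definition tensor_relators :: "(('a::real_vector \<times> 'b::real_vector) \<Rightarrow>\<^sub>0 real) set" where
  "tensor_relators =
     (let e = (\<lambda>x y. Poly_Mapping.single (x, y) 1) in
       {e (x + x') y - e x y - e x' y | x x' y. True} \<union>
       {e x (y + y') - e x y - e x y' | x y y'. True} \<union>
       {e (c *\<^sub>R x) y - c *\<^sub>R e x y | c x y. True} \<union>
       {e x (c *\<^sub>R y) - c *\<^sub>R e x y | c x y. True})"

quotient_type (overloaded) ('a, 'b) alg_tensor =
  "('a::real_vector \<times> 'b::real_vector) \<Rightarrow>\<^sub>0 real" / "\<lambda>u v. u - v \<in> span tensor_relators"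
proof (intro equivpI reflpI sympI transpI)
  fix u v w :: "('a \<times> 'b) \<Rightarrow>\<^sub>0 real"
  show "u - u \<in> span tensor_relators"
    by (simp add: span_zero)
  show "v - u \<in> span tensor_relators" if "u - v \<in> span tensor_relators"
    using span_neg[OF that] by simp
  show "u - w \<in> span tensor_relators"
    if "u - v \<in> span tensor_relators" "v - w \<in> span tensor_relators"
    using span_add[OF that] by simp
qed

instantiation alg_tensor :: (real_vector, real_vector) real_vector
begin

lift_definition zero_alg_tensor :: "('a, 'b) alg_tensor" is 0 .

lift_definition plus_alg_tensor ::
  "('a, 'b) alg_tensor \<Rightarrow> ('a, 'b) alg_tensor \<Rightarrow> ('a, 'b) alg_tensor" is "(+)"
  by (metis span_add add_diff_add)

lift_definition uminus_alg_tensor :: "('a, 'b) alg_tensor \<Rightarrow> ('a, 'b) alg_tensor" is uminus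
  by (metis span_neg minus_diff_minus)

lift_definition minus_alg_tensor ::
  "('a, 'b) alg_tensor \<Rightarrow> ('a, 'b) alg_tensor \<Rightarrow> ('a, 'b) alg_tensor" is "(-)"
proof -
  fix a b c d :: "('a \<times> 'b) \<Rightarrow>\<^sub>0 real"
  assume "a - b \<in> span tensor_relators" "c - d \<in> span tensor_relators"
  from span_diff[OF this] show "a - c - (b - d) \<in> span tensor_relators"
    by (simp add: algebra_simps)
qed

lift_definition scaleR_alg_tensor :: "real \<Rightarrow> ('a, 'b) alg_tensor \<Rightarrow> ('a, 'b) alg_tensor"
  is "scaleR"
  by (metis span_scale scaleR_diff_right)

instance
  by (intro_classes; transfer) (simp_all add: algebra_simps span_zero)

end

lift_definition tensor_pure :: "'a::real_vector \<Rightarrow> 'b::real_vector \<Rightarrow> ('a, 'b) alg_tensor"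
  is "\<lambda>x y. Poly_Mapping.single (x, y) 1" .

lemma tensor_pure_add_left: "tensor_pure (x + x') y = tensor_pure x y + tensor_pure x' y"
  by transfer (rule span_base, unfold tensor_relators_def Let_def diff_diff_add[symmetric],
    rule UnI1, rule UnI1, rule UnI1, intro CollectI exI conjI TrueI, rule refl)

lemma tensor_pure_add_right: "tensor_pure x (y + y') = tensor_pure x y + tensor_pure x y'"
  by transfer (rule span_base, unfold tensor_relators_def Let_def diff_diff_add[symmetric],
    rule UnI1, rule UnI1, rule UnI2, intro CollectI exI conjI TrueI, rule refl)

lemma tensor_pure_scaleR_left: "tensor_pure (c *\<^sub>R x) y = c *\<^sub>R tensor_pure x y"
  by transfer (rule span_base, unfold tensor_relators_def Let_def diff_diff_add[symmetric],
    rule UnI1, rule UnI2, intro CollectI exI conjI TrueI, rule refl)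

lemma tensor_pure_scaleR_right: "tensor_pure x (c *\<^sub>R y) = c *\<^sub>R tensor_pure x y"
  by transfer (rule span_base, unfold tensor_relators_def Let_def diff_diff_add[symmetric],
    rule UnI2, intro CollectI exI conjI TrueI, rule refl)

section \<open>The projective norm\<close>

definition proj_costs :: "('a::real_normed_vector, 'b::real_normed_vector) alg_tensor \<Rightarrow> real set" where
  "proj_costs z = {\<Sum>i<k. norm (x i) * norm (y i) | (k::nat) x y. z = (\<Sum>i<k. tensor_pure (x i) (y i))}"

definition proj_norm :: "('a::real_normed_vector, 'b::real_normed_vector) alg_tensor \<Rightarrow> real" where
  "proj_norm z = Inf (proj_costs z)"

lemma proj_costs_nonneg: "r \<in> proj_costs z \<Longrightarrow> 0 \<le> r"
  by (auto simp: proj_costs_def intro!: sum_nonneg)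

lemma proj_costs_zero: "0 \<in> proj_costs 0"
  unfolding proj_costs_def by (intro CollectI exI[of _ 0]) auto

lemma proj_costs_pure: "norm x * norm y \<in> proj_costs (tensor_pure x y)"
  unfolding proj_costs_def
  by (intro CollectI exI[of _ 1] exI[of _ "\<lambda>_. x"] exI[of _ "\<lambda>_. y"]) auto

lemma sum_append_lessThan:
  fixes f g :: "nat \<Rightarrow> 'c::comm_monoid_add"
  shows "(\<Sum>i<k + l. if i < k then f i else g (i - k)) = (\<Sum>i<k. f i) + (\<Sum>i<l. g i)"
proof -
  have "{..<k + l} = {..<k} \<union> {k..<k + l}"
    by auto
  then have "(\<Sum>i<k + l. if i < k then f i else g (i - k)) =
      (\<Sum>i<k. if i < k then f i else g (i - k)) + (\<Sum>i=k..<k + l. if i < k then f i else g (i - k))"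
    by (simp add: sum.union_disjoint ivl_disj_int)
  also have "(\<Sum>i=k..<k + l. if i < k then f i else g (i - k)) = (\<Sum>i=0..<l. g i)"
    using sum.shift_bounds_nat_ivl[of "\<lambda>i. if i < k then f i else g (i - k)" 0 k l]
    by (simp add: add.commute)
  finally show ?thesis
    by (simp add: atLeast0LessThan)
qed

lemma proj_costs_add:
  assumes "r \<in> proj_costs z" "s \<in> proj_costs w"
  shows "r + s \<in> proj_costs (z + w)"
proof -
  obtain k :: nat and x y where 1: "z = (\<Sum>i<k. tensor_pure (x i) (y i))" "r = (\<Sum>i<k. norm (x i) * norm (y i))"
    using assms(1) unfolding proj_costs_def by blast
  obtain l :: nat and x' y' where 2: "w = (\<Sum>i<l. tensor_pure (x' i) (y' i))" "s = (\<Sum>i<l. norm (x' i) * norm (y' i))"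
    using assms(2) unfolding proj_costs_def by blast
  define X where "X i = (if i < k then x i else x' (i - k))" for i
  define Y where "Y i = (if i < k then y i else y' (i - k))" for i
  have "z + w = (\<Sum>i<k + l. tensor_pure (X i) (Y i))"
    unfolding 1 2 sum_append_lessThan[symmetric] by (intro sum.cong) (auto simp: X_def Y_def)
  moreover have "r + s = (\<Sum>i<k + l. norm (X i) * norm (Y i))"
    unfolding 1 2 sum_append_lessThan[symmetric] by (intro sum.cong) (auto simp: X_def Y_def)
  ultimately show ?thesis
    unfolding proj_costs_def by blast
qed

lemma proj_costs_scaleR:
  assumes "r \<in> proj_costs z"
  shows "\<bar>c\<bar> * r \<in> proj_costs (c *\<^sub>R z)"
proof -
  obtain k :: nat and x y where 1: "z = (\<Sum>i<k. tensor_pure (x i) (y i))" "r = (\<Sum>i<k. norm (x i) * norm (y i))"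
    using assms unfolding proj_costs_def by blast
  have "c *\<^sub>R z = (\<Sum>i<k. tensor_pure (c *\<^sub>R x i) (y i))"
    unfolding 1 by (simp add: scaleR_sum_right tensor_pure_scaleR_left)
  moreover have "\<bar>c\<bar> * r = (\<Sum>i<k. norm (c *\<^sub>R x i) * norm (y i))"
    unfolding 1 by (simp add: sum_distrib_left mult.assoc)
  ultimately show ?thesis
    unfolding proj_costs_def by (intro CollectI exI[of _ k] exI[of _ "\<lambda>i. c *\<^sub>R x i"] exI[of _ y]) auto
qed

lemma lookup_scaleR:
  "Poly_Mapping.lookup (c *\<^sub>R u) i = c *\<^sub>R Poly_Mapping.lookup (u :: 'c \<Rightarrow>\<^sub>0 'd::real_vector) i"
proof -
  have "finite {i. c *\<^sub>R Poly_Mapping.lookup u i \<noteq> 0}"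
    by (rule finite_subset[OF _ finite_lookup[of u]]) auto
  then show ?thesis
    by (simp add: scaleR_poly_mapping_def)
qed

lemma proj_costs_nonempty: "proj_costs z \<noteq> {}"
proof -
  have "\<exists>r. r \<in> proj_costs (abs_alg_tensor u)" for u :: "('a \<times> 'b) \<Rightarrow>\<^sub>0 real"
  proof (induction u rule: Poly_Mapping.update_induct)
    case const
    show ?case
      using proj_costs_zero by (metis zero_alg_tensor.abs_eq)
  next
    case (update u p c)
    obtain x y where p: "p = (x, y)" by fastforce
    have "Poly_Mapping.update p c u = c *\<^sub>R Poly_Mapping.single (x, y) 1 + u"
      using update(1) unfolding p
      by (intro poly_mapping_eqI) (auto simp: lookup_update lookup_add lookup_scaleR lookup_single when_def in_keys_iff)
    then have "abs_alg_tensor (Poly_Mapping.update p c u) = c *\<^sub>R tensor_pure x y + abs_alg_tensor u"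
      by (simp add: tensor_pure.abs_eq scaleR_alg_tensor.abs_eq plus_alg_tensor.abs_eq)
    then show ?case
      using update(3) proj_costs_add proj_costs_scaleR[OF proj_costs_pure] by metis
  qed
  from this[of "rep_alg_tensor z"] show ?thesis
    unfolding Quotient3_abs_rep[OF Quotient3_alg_tensor] by blast
qed

lemma proj_norm_le: "r \<in> proj_costs z \<Longrightarrow> proj_norm z \<le> r"
  unfolding proj_norm_def by (rule cInf_lower) (auto intro: bdd_belowI proj_costs_nonneg)

lemma proj_norm_nonneg: "0 \<le> proj_norm z"
  unfolding proj_norm_def by (rule cInf_greatest) (auto simp: proj_costs_nonempty proj_costs_nonneg)

lemma proj_norm_approx:
  assumes "e > 0"
  obtains r where "r \<in> proj_costs z" "r < proj_norm z + e"
  using cInf_lessD[OF proj_costs_nonempty, of z "proj_norm z + e"] assms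
  unfolding proj_norm_def by auto

lemma proj_norm_zero [simp]: "proj_norm 0 = 0"
  using proj_norm_le[OF proj_costs_zero] proj_norm_nonneg[of 0] by (rule antisym)

lemma proj_norm_pure_le: "proj_norm (tensor_pure x y) \<le> norm x * norm y"
  by (rule proj_norm_le[OF proj_costs_pure])

lemma proj_norm_triangle: "proj_norm (z + w) \<le> proj_norm z + proj_norm w"
proof (rule field_le_epsilon)
  fix e :: real assume "e > 0"
  then have e: "e / 2 > 0" by simp
  obtain r where r: "r \<in> proj_costs z" "r < proj_norm z + e / 2"
    by (rule proj_norm_approx[OF e])
  obtain s where s: "s \<in> proj_costs w" "s < proj_norm w + e / 2"
    by (rule proj_norm_approx[OF e])
  show "proj_norm (z + w) \<le> proj_norm z + proj_norm w + e"
    using proj_norm_le[OF proj_costs_add[OF r(1) s(1)]] r(2) s(2) by linarith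
qed

lemma proj_norm_scaleR_le: "proj_norm (c *\<^sub>R z) \<le> \<bar>c\<bar> * proj_norm z"
proof (rule field_le_epsilon)
  fix e :: real assume "e > 0"
  then have e: "e / (\<bar>c\<bar> + 1) > 0" by simp
  obtain r where r: "r \<in> proj_costs z" "r < proj_norm z + e / (\<bar>c\<bar> + 1)"
    by (rule proj_norm_approx[OF e])
  have "proj_norm (c *\<^sub>R z) \<le> \<bar>c\<bar> * r"
    by (rule proj_norm_le[OF proj_costs_scaleR[OF r(1)]])
  also have "\<dots> \<le> \<bar>c\<bar> * (proj_norm z + e / (\<bar>c\<bar> + 1))"
    using r(2) by (intro mult_left_mono) auto
  also have "\<dots> = \<bar>c\<bar> * proj_norm z + e * (\<bar>c\<bar> / (\<bar>c\<bar> + 1))"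
    by (simp add: field_simps)
  also have "\<dots> \<le> \<bar>c\<bar> * proj_norm z + e"
    using \<open>e > 0\<close> by (intro add_left_mono) (simp add: field_simps)
  finally show "proj_norm (c *\<^sub>R z) \<le> \<bar>c\<bar> * proj_norm z + e" .
qed

lemma proj_norm_scaleR: "proj_norm (c *\<^sub>R z) = \<bar>c\<bar> * proj_norm z"
proof (cases "c = 0")
  case False
  have "\<bar>c\<bar> * proj_norm z = \<bar>c\<bar> * proj_norm (inverse c *\<^sub>R (c *\<^sub>R z))"
    using False by simp
  also have "\<dots> \<le> \<bar>c\<bar> * (\<bar>inverse c\<bar> * proj_norm (c *\<^sub>R z))"
    by (intro mult_left_mono proj_norm_scaleR_le) auto
  also have "\<dots> = proj_norm (c *\<^sub>R z)"
    using False by (simp add: abs_inverse)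
  finally show ?thesis
    using proj_norm_scaleR_le[of c z] by linarith
qed simp

lemma proj_norm_minus: "proj_norm (- z) = proj_norm z"
  using proj_norm_scaleR[of "-1" z] by simp

lemma proj_norm_minus_commute: "proj_norm (z - w) = proj_norm (w - z)"
  using proj_norm_minus[of "z - w"] by simp

lemma proj_norm_triangle_diff: "proj_norm (a - c) \<le> proj_norm (a - b) + proj_norm (b - c)"
  using proj_norm_triangle[of "a - b" "b - c"] by simp

lemma proj_norm_diff_ineq: "\<bar>proj_norm z - proj_norm w\<bar> \<le> proj_norm (z - w)"
  using proj_norm_triangle[of "z - w" w] proj_norm_triangle[of "w - z" z]
    proj_norm_minus_commute[of z w] by simp

section \<open>The projective tensor product\<close>

text \<open>The completion, built from Cauchy sequences, two being identified when their difference tends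
  to zero in \<^const>\<open>proj_norm\<close>. The construction uses only that \<^const>\<open>proj_norm\<close> is a seminorm; that
  it separates points (so that the embedding is injective) is true but not needed here.\<close>

definition proj_Cauchy ::
  "(nat \<Rightarrow> ('a::real_normed_vector, 'b::real_normed_vector) alg_tensor) \<Rightarrow> bool" where
  "proj_Cauchy u \<longleftrightarrow> (\<forall>e>0. \<exists>N. \<forall>m\<ge>N. \<forall>n\<ge>N. proj_norm (u m - u n) < e)"

lemma proj_Cauchy_const: "proj_Cauchy (\<lambda>_. z)"
  by (simp add: proj_Cauchy_def)

lemma proj_Cauchy_add:
  assumes "proj_Cauchy u" "proj_Cauchy v"
  shows "proj_Cauchy (\<lambda>n. u n + v n)"
  unfolding proj_Cauchy_def
proof (intro allI impI)
  fix e :: real assume "e > 0"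
  then have e: "e / 2 > 0" by simp
  obtain M where M: "\<And>m n. m \<ge> M \<Longrightarrow> n \<ge> M \<Longrightarrow> proj_norm (u m - u n) < e / 2"
    using assms(1) e unfolding proj_Cauchy_def by meson
  obtain N where N: "\<And>m n. m \<ge> N \<Longrightarrow> n \<ge> N \<Longrightarrow> proj_norm (v m - v n) < e / 2"
    using assms(2) e unfolding proj_Cauchy_def by meson
  have "proj_norm (u m + v m - (u n + v n)) < e" if "m \<ge> max M N" "n \<ge> max M N" for m n
    using proj_norm_triangle[of "u m - u n" "v m - v n"] M[of m n] N[of m n] that
    by (simp add: add_diff_add)
  then show "\<exists>N. \<forall>m\<ge>N. \<forall>n\<ge>N. proj_norm (u m + v m - (u n + v n)) < e"
    by blast
qed

lemma proj_Cauchy_scaleR: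
  assumes "proj_Cauchy u"
  shows "proj_Cauchy (\<lambda>n. c *\<^sub>R u n)"
  unfolding proj_Cauchy_def
proof (intro allI impI)
  fix e :: real assume "e > 0"
  then have e: "e / (\<bar>c\<bar> + 1) > 0" by simp
  obtain M where M: "\<And>m n. m \<ge> M \<Longrightarrow> n \<ge> M \<Longrightarrow> proj_norm (u m - u n) < e / (\<bar>c\<bar> + 1)"
    using assms(1) e unfolding proj_Cauchy_def by meson
  have "proj_norm (c *\<^sub>R u m - c *\<^sub>R u n) < e" if "m \<ge> M" "n \<ge> M" for m n
  proof -
    have "proj_norm (c *\<^sub>R u m - c *\<^sub>R u n) = \<bar>c\<bar> * proj_norm (u m - u n)"
      by (simp add: proj_norm_scaleR flip: scaleR_diff_right)
    also have "\<dots> \<le> (\<bar>c\<bar> + 1) * proj_norm (u m - u n)"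
      by (intro mult_right_mono proj_norm_nonneg) auto
    also have "\<dots> < e"
      using M[OF that] by (simp add: field_simps)
    finally show ?thesis .
  qed
  then show "\<exists>N. \<forall>m\<ge>N. \<forall>n\<ge>N. proj_norm (c *\<^sub>R u m - c *\<^sub>R u n) < e"
    by blast
qed

lemma proj_Cauchy_minus: "proj_Cauchy u \<Longrightarrow> proj_Cauchy (\<lambda>n. - u n)"
  using proj_Cauchy_scaleR[of u "-1"] by simp

lemma proj_Cauchy_diff: "proj_Cauchy u \<Longrightarrow> proj_Cauchy v \<Longrightarrow> proj_Cauchy (\<lambda>n. u n - v n)"
  using proj_Cauchy_add[OF _ proj_Cauchy_minus, of u v] by simp

lemma proj_Cauchy_convergent:
  assumes "proj_Cauchy u"
  shows "convergent (\<lambda>n. proj_norm (u n))"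
proof (rule Cauchy_convergent, rule metric_CauchyI)
  fix e :: real assume "e > 0"
  then obtain N where "\<And>m n. m \<ge> N \<Longrightarrow> n \<ge> N \<Longrightarrow> proj_norm (u m - u n) < e"
    using assms unfolding proj_Cauchy_def by meson
  then show "\<exists>N. \<forall>m\<ge>N. \<forall>n\<ge>N. dist (proj_norm (u m)) (proj_norm (u n)) < e"
    by (metis dist_real_def proj_norm_diff_ineq order_le_less_trans)
qed

lemma null_add:
  assumes "(\<lambda>n. proj_norm (u n)) \<longlonglongrightarrow> 0" "(\<lambda>n. proj_norm (v n)) \<longlonglongrightarrow> 0"
  shows "(\<lambda>n. proj_norm (u n + v n)) \<longlonglongrightarrow> 0"
  by (rule tendsto_sandwich[OF _ _ tendsto_const tendsto_add_zero[OF assms]])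
    (auto simp: proj_norm_nonneg proj_norm_triangle)

quotient_type (overloaded) ('a, 'b) proj_tensor =
  "nat \<Rightarrow> ('a::real_normed_vector, 'b::real_normed_vector) alg_tensor" /
  partial: "\<lambda>u v. proj_Cauchy u \<and> proj_Cauchy v \<and> (\<lambda>n. proj_norm (u n - v n)) \<longlonglongrightarrow> 0"
proof (rule part_equivpI)
  show "\<exists>u::nat \<Rightarrow> ('a, 'b) alg_tensor.
      proj_Cauchy u \<and> proj_Cauchy u \<and> (\<lambda>n. proj_norm (u n - u n)) \<longlonglongrightarrow> 0"
    using proj_Cauchy_const[of 0] by (intro exI[of _ "\<lambda>_. 0"]) simp
  show "symp (\<lambda>u v::nat \<Rightarrow> ('a, 'b) alg_tensor.
      proj_Cauchy u \<and> proj_Cauchy v \<and> (\<lambda>n. proj_norm (u n - v n)) \<longlonglongrightarrow> 0)"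
    by (auto intro!: sympI simp: proj_norm_minus_commute)
  show "transp (\<lambda>u v::nat \<Rightarrow> ('a, 'b) alg_tensor.
      proj_Cauchy u \<and> proj_Cauchy v \<and> (\<lambda>n. proj_norm (u n - v n)) \<longlonglongrightarrow> 0)"
  proof (intro transpI conjI; (elim conjE)?)
    fix u v w :: "nat \<Rightarrow> ('a, 'b) alg_tensor"
    assume "(\<lambda>n. proj_norm (u n - v n)) \<longlonglongrightarrow> 0" "(\<lambda>n. proj_norm (v n - w n)) \<longlonglongrightarrow> 0"
    from null_add[OF this] show "(\<lambda>n. proj_norm (u n - w n)) \<longlonglongrightarrow> 0"
      by simp
  qed
qed

instantiation proj_tensor :: (real_normed_vector, real_normed_vector) real_vector
begin

lift_definition zero_proj_tensor :: "('a, 'b) proj_tensor" is "\<lambda>_. 0"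
  by (simp add: proj_Cauchy_const)

lift_definition plus_proj_tensor ::
  "('a, 'b) proj_tensor \<Rightarrow> ('a, 'b) proj_tensor \<Rightarrow> ('a, 'b) proj_tensor" is "\<lambda>u v n. u n + v n"
  using null_add by (fastforce simp: add_diff_add intro: proj_Cauchy_add)

lift_definition uminus_proj_tensor :: "('a, 'b) proj_tensor \<Rightarrow> ('a, 'b) proj_tensor"
  is "\<lambda>u n. - u n"
proof (elim conjE, intro conjI)
  fix u v :: "nat \<Rightarrow> ('a, 'b) alg_tensor"
  assume *: "(\<lambda>n. proj_norm (u n - v n)) \<longlonglongrightarrow> 0"
  show "(\<lambda>n. proj_norm (- u n - - v n)) \<longlonglongrightarrow> 0"
    using * by (simp add: proj_norm_minus_commute[of "u _"])
qed (simp_all add: proj_Cauchy_minus)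

definition minus_proj_tensor ::
  "('a, 'b) proj_tensor \<Rightarrow> ('a, 'b) proj_tensor \<Rightarrow> ('a, 'b) proj_tensor" where
  "minus_proj_tensor z w = z + (- w)"

lift_definition scaleR_proj_tensor :: "real \<Rightarrow> ('a, 'b) proj_tensor \<Rightarrow> ('a, 'b) proj_tensor"
  is "\<lambda>c u n. c *\<^sub>R u n"
proof (elim conjE, intro conjI)
  fix c :: real and u v :: "nat \<Rightarrow> ('a, 'b) alg_tensor"
  assume "(\<lambda>n. proj_norm (u n - v n)) \<longlonglongrightarrow> 0"
  from tendsto_mult_right_zero[OF this, of "\<bar>c\<bar>"]
  show "(\<lambda>n. proj_norm (c *\<^sub>R u n - c *\<^sub>R v n)) \<longlonglongrightarrow> 0"
    by (simp add: proj_norm_scaleR flip: scaleR_diff_right)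
qed (simp_all add: proj_Cauchy_scaleR)

instance
proof
  fix a b c :: "('a, 'b) proj_tensor" and r s :: real
  show "a + b + c = a + (b + c)"
    by transfer (simp add: algebra_simps proj_Cauchy_add)
  show "a + b = b + a"
    by transfer (simp add: algebra_simps proj_Cauchy_add)
  show "0 + a = a"
    by transfer simp
  show "- a + a = 0"
    by transfer (simp add: proj_Cauchy_const)
  show "a - b = a + - b"
    by (rule minus_proj_tensor_def)
  show "r *\<^sub>R (a + b) = r *\<^sub>R a + r *\<^sub>R b"
    by transfer (simp add: scaleR_add_right proj_Cauchy_add proj_Cauchy_scaleR)
  show "(r + s) *\<^sub>R a = r *\<^sub>R a + s *\<^sub>R a"
    by transfer (simp add: scaleR_add_left proj_Cauchy_add proj_Cauchy_scaleR)
  show "r *\<^sub>R s *\<^sub>R a = (r * s) *\<^sub>R a"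
    by transfer (simp add: proj_Cauchy_scaleR)
  show "1 *\<^sub>R a = a"
    by transfer simp
qed

end

instantiation proj_tensor :: (real_normed_vector, real_normed_vector) real_normed_vector
begin

lift_definition norm_proj_tensor :: "('a, 'b) proj_tensor \<Rightarrow> real"
  is "\<lambda>u. lim (\<lambda>n. proj_norm (u n))"
proof (elim conjE)
  fix u v :: "nat \<Rightarrow> ('a, 'b) alg_tensor"
  assume u: "proj_Cauchy u" and v: "proj_Cauchy v"
    and uv: "(\<lambda>n. proj_norm (u n - v n)) \<longlonglongrightarrow> 0"
  have diff: "(\<lambda>n. proj_norm (u n) - proj_norm (v n)) \<longlonglongrightarrow> 0"
    by (rule tendsto_rabs_zero_cancel, rule tendsto_sandwich[OF _ _ tendsto_const uv])
      (auto simp: proj_norm_diff_ineq)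
  have lims: "(\<lambda>n. proj_norm (u n)) \<longlonglongrightarrow> lim (\<lambda>n. proj_norm (u n))"
    "(\<lambda>n. proj_norm (v n)) \<longlonglongrightarrow> lim (\<lambda>n. proj_norm (v n))"
    using proj_Cauchy_convergent[OF u] proj_Cauchy_convergent[OF v]
    by (simp_all add: convergent_LIMSEQ_iff)
  show "lim (\<lambda>n. proj_norm (u n)) = lim (\<lambda>n. proj_norm (v n))"
    using LIMSEQ_unique[OF diff tendsto_diff[OF lims]] by simp
qed

definition dist_proj_tensor :: "('a, 'b) proj_tensor \<Rightarrow> ('a, 'b) proj_tensor \<Rightarrow> real" where
  "dist_proj_tensor z w = norm (z - w)"

definition sgn_proj_tensor :: "('a, 'b) proj_tensor \<Rightarrow> ('a, 'b) proj_tensor" where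
  "sgn_proj_tensor z = z /\<^sub>R norm z"

definition uniformity_proj_tensor :: "(('a, 'b) proj_tensor \<times> ('a, 'b) proj_tensor) filter" where
  "uniformity_proj_tensor = (INF e\<in>{0<..}. principal {(z, w). dist z w < e})"

definition open_proj_tensor :: "('a, 'b) proj_tensor set \<Rightarrow> bool" where
  "open_proj_tensor U \<longleftrightarrow> (\<forall>z\<in>U. \<forall>\<^sub>F (z', w) in uniformity. z' = z \<longrightarrow> w \<in> U)"

instance
proof
  fix a b :: "('a, 'b) proj_tensor" and r :: real
  show "dist a b = norm (a - b)"
    by (rule dist_proj_tensor_def)
  show "sgn a = a /\<^sub>R norm a"
    by (rule sgn_proj_tensor_def)
  show "uniformity = (INF e\<in>{0<..}. principal {(z, w). dist (z::('a, 'b) proj_tensor) w < e})"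
    by (rule uniformity_proj_tensor_def)
  show "open U \<longleftrightarrow> (\<forall>z\<in>U. \<forall>\<^sub>F (z', w) in uniformity. z' = z \<longrightarrow> w \<in> U)"
    for U :: "('a, 'b) proj_tensor set"
    by (rule open_proj_tensor_def)
  show "norm a = 0 \<longleftrightarrow> a = 0"
  proof transfer
    fix u :: "nat \<Rightarrow> ('a, 'b) alg_tensor"
    assume "proj_Cauchy u \<and> proj_Cauchy u \<and> (\<lambda>n. proj_norm (u n - u n)) \<longlonglongrightarrow> 0"
    then have u: "proj_Cauchy u" by simp
    then have "(\<lambda>n. proj_norm (u n)) \<longlonglongrightarrow> lim (\<lambda>n. proj_norm (u n))"
      using proj_Cauchy_convergent by (simp add: convergent_LIMSEQ_iff)
    then show "lim (\<lambda>n. proj_norm (u n)) = 0 \<longleftrightarrow>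
        proj_Cauchy u \<and> proj_Cauchy (\<lambda>_. 0 :: ('a, 'b) alg_tensor) \<and> (\<lambda>n. proj_norm (u n - 0)) \<longlonglongrightarrow> 0"
      using u by (auto simp: proj_Cauchy_const dest: limI)
  qed
  show "norm (a + b) \<le> norm a + norm b"
  proof transfer
    fix u v :: "nat \<Rightarrow> ('a, 'b) alg_tensor"
    assume "proj_Cauchy u \<and> proj_Cauchy u \<and> (\<lambda>n. proj_norm (u n - u n)) \<longlonglongrightarrow> 0"
      "proj_Cauchy v \<and> proj_Cauchy v \<and> (\<lambda>n. proj_norm (v n - v n)) \<longlonglongrightarrow> 0"
    then have "proj_Cauchy u" "proj_Cauchy v" "proj_Cauchy (\<lambda>n. u n + v n)"
      by (auto intro: proj_Cauchy_add)
    then have "(\<lambda>n. proj_norm (u n)) \<longlonglongrightarrow> lim (\<lambda>n. proj_norm (u n))"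
      "(\<lambda>n. proj_norm (v n)) \<longlonglongrightarrow> lim (\<lambda>n. proj_norm (v n))"
      "(\<lambda>n. proj_norm (u n + v n)) \<longlonglongrightarrow> lim (\<lambda>n. proj_norm (u n + v n))"
      by (auto dest!: proj_Cauchy_convergent simp: convergent_LIMSEQ_iff)
    then show "lim (\<lambda>n. proj_norm (u n + v n)) \<le> lim (\<lambda>n. proj_norm (u n)) + lim (\<lambda>n. proj_norm (v n))"
      by (intro tendsto_le[OF _ tendsto_add]) (auto simp: proj_norm_triangle)
  qed
  show "norm (r *\<^sub>R a) = \<bar>r\<bar> * norm a"
  proof transfer
    fix r :: real and u :: "nat \<Rightarrow> ('a, 'b) alg_tensor"
    assume "proj_Cauchy u \<and> proj_Cauchy u \<and> (\<lambda>n. proj_norm (u n - u n)) \<longlonglongrightarrow> 0"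
    then have "(\<lambda>n. proj_norm (u n)) \<longlonglongrightarrow> lim (\<lambda>n. proj_norm (u n))"
      by (auto dest!: proj_Cauchy_convergent simp: convergent_LIMSEQ_iff)
    from tendsto_mult_left[OF this, of "\<bar>r\<bar>"]
    show "lim (\<lambda>n. proj_norm (r *\<^sub>R u n)) = \<bar>r\<bar> * lim (\<lambda>n. proj_norm (u n))"
      by (simp add: proj_norm_scaleR limI)
  qed
qed

end

definition embed_tensor ::
  "('a::real_normed_vector, 'b::real_normed_vector) alg_tensor \<Rightarrow> ('a, 'b) proj_tensor" where
  "embed_tensor z = abs_proj_tensor (\<lambda>_. z)"

lemma embed_tensor_add: "embed_tensor (z + w) = embed_tensor z + embed_tensor w"
  by (simp add: embed_tensor_def plus_proj_tensor.abs_eq proj_Cauchy_const)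

lemma embed_tensor_scaleR: "embed_tensor (c *\<^sub>R z) = c *\<^sub>R embed_tensor z"
  by (simp add: embed_tensor_def scaleR_proj_tensor.abs_eq proj_Cauchy_const)

lemma embed_tensor_diff: "embed_tensor (z - w) = embed_tensor z - embed_tensor w"
  using embed_tensor_add[of z "(-1) *\<^sub>R w"] embed_tensor_scaleR[of "-1" w] by simp

lemma norm_embed_tensor: "norm (embed_tensor z) = proj_norm z"
  by (simp add: embed_tensor_def norm_proj_tensor.abs_eq proj_Cauchy_const limI)

lemma embed_tensor_LIMSEQ:
  assumes "proj_Cauchy u"
  shows "(\<lambda>n. embed_tensor (u n)) \<longlonglongrightarrow> abs_proj_tensor u"
proof (rule metric_LIMSEQ_I)
  fix e :: real assume "e > 0"
  then have "e / 2 > 0" by simp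
  then obtain N where N: "\<And>m n. m \<ge> N \<Longrightarrow> n \<ge> N \<Longrightarrow> proj_norm (u m - u n) < e / 2"
    using assms unfolding proj_Cauchy_def by meson
  have "dist (embed_tensor (u n)) (abs_proj_tensor u) < e" if "n \<ge> N" for n
  proof -
    have C: "proj_Cauchy (\<lambda>m. u n - u m)"
      by (intro proj_Cauchy_diff proj_Cauchy_const assms)
    have "- abs_proj_tensor u = abs_proj_tensor (\<lambda>m. - u m)"
      by (rule uminus_proj_tensor.abs_eq) (simp add: eq_onp_def assms)
    moreover have "embed_tensor (u n) = abs_proj_tensor (\<lambda>_. u n)"
      by (rule embed_tensor_def)
    moreover have "abs_proj_tensor (\<lambda>_. u n) + abs_proj_tensor (\<lambda>m. - u m) =
        abs_proj_tensor (\<lambda>m. u n + - u m)"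
      by (rule plus_proj_tensor.abs_eq)
        (simp_all add: eq_onp_def assms proj_Cauchy_const proj_Cauchy_minus)
    ultimately have "embed_tensor (u n) - abs_proj_tensor u = abs_proj_tensor (\<lambda>m. u n - u m)"
      by (simp add: minus_proj_tensor_def)
    moreover have "norm (abs_proj_tensor (\<lambda>m. u n - u m)) = lim (\<lambda>m. proj_norm (u n - u m))"
      by (rule norm_proj_tensor.abs_eq) (simp add: eq_onp_def C)
    moreover have "(\<lambda>m. proj_norm (u n - u m)) \<longlonglongrightarrow> lim (\<lambda>m. proj_norm (u n - u m))"
      using proj_Cauchy_convergent[OF C] by (simp add: convergent_LIMSEQ_iff)
    then have "lim (\<lambda>m. proj_norm (u n - u m)) \<le> e / 2"
      using N that by (intro LIMSEQ_le_const2) (auto intro!: exI[of _ N] less_imp_le)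
    ultimately show ?thesis
      using \<open>e > 0\<close> by (simp add: dist_norm)
  qed
  then show "\<exists>N. \<forall>n\<ge>N. dist (embed_tensor (u n)) (abs_proj_tensor u) < e"
    by blast
qed

lemma embed_tensor_dense:
  assumes "e > 0"
  obtains w where "dist (embed_tensor w) z < e"
proof -
  obtain u where u: "proj_Cauchy u" "z = abs_proj_tensor u"
    using Quotient3_abs_rep[OF Quotient3_proj_tensor, of z]
      Quotient3_rep_reflp[OF Quotient3_proj_tensor, of z] that[of "rep_proj_tensor z"] by simp
  then show ?thesis
    using metric_LIMSEQ_D[OF embed_tensor_LIMSEQ[OF u(1)] assms] that by blast
qed

instance proj_tensor :: (real_normed_vector, real_normed_vector) banach
proof
  fix Z :: "nat \<Rightarrow> ('a, 'b) proj_tensor"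
  assume Z: "Cauchy Z"
  have "\<exists>w. dist (embed_tensor w) (Z n) < inverse (real (Suc n))" for n
    by (rule embed_tensor_dense[of "inverse (real (Suc n))" "Z n"]) auto
  then obtain u where u: "\<And>n. dist (embed_tensor (u n)) (Z n) < inverse (real (Suc n))"
    by metis
  have lim0: "(\<lambda>n. dist (embed_tensor (u n)) (Z n)) \<longlonglongrightarrow> 0"
    by (rule tendsto_sandwich[OF _ _ tendsto_const LIMSEQ_inverse_real_of_nat])
      (auto intro!: always_eventually less_imp_le u simp del: of_nat_Suc)
  have "proj_Cauchy u"
    unfolding proj_Cauchy_def
  proof (intro allI impI)
    fix e :: real assume "e > 0"
    then have e: "e / 3 > 0" by simp
    obtain M where M: "\<And>m n. m \<ge> M \<Longrightarrow> n \<ge> M \<Longrightarrow> dist (Z m) (Z n) < e / 3"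
      using metric_CauchyD[OF Z e] by blast
    obtain N where N: "\<And>n. n \<ge> N \<Longrightarrow> dist (embed_tensor (u n)) (Z n) < e / 3"
      using metric_LIMSEQ_D[OF lim0 e] by auto
    have "proj_norm (u m - u n) < e" if "m \<ge> max M N" "n \<ge> max M N" for m n
    proof -
      have "proj_norm (u m - u n) = dist (embed_tensor (u m)) (embed_tensor (u n))"
        by (simp add: dist_norm flip: embed_tensor_diff norm_embed_tensor)
      also have "\<dots> \<le> dist (embed_tensor (u m)) (Z m) + dist (Z m) (Z n) + dist (embed_tensor (u n)) (Z n)"
        using dist_triangle[of "embed_tensor (u m)" "embed_tensor (u n)" "Z m"]
          dist_triangle[of "Z m" "embed_tensor (u n)" "Z n"] dist_commute[of "Z n" "embed_tensor (u n)"]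
        by linarith
      also have "\<dots> < e"
        using M[of m n] N[of m] N[of n] that by simp
      finally show ?thesis .
    qed
    then show "\<exists>N. \<forall>m\<ge>N. \<forall>n\<ge>N. proj_norm (u m - u n) < e"
      by blast
  qed
  then have "(\<lambda>n. embed_tensor (u n)) \<longlonglongrightarrow> abs_proj_tensor u"
    by (rule embed_tensor_LIMSEQ)
  moreover have "(\<lambda>n. embed_tensor (u n) - Z n) \<longlonglongrightarrow> 0"
    using lim0 by (simp add: dist_norm tendsto_norm_zero_iff)
  ultimately have "Z \<longlonglongrightarrow> abs_proj_tensor u"
    by (rule Lim_transform2)
  then show "convergent Z"
    by (rule convergentI)
qed

definition proj_pure ::
  "'a::real_normed_vector \<Rightarrow> 'b::real_normed_vector \<Rightarrow> ('a, 'b) proj_tensor"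
  (infixr "\<otimes>\<^sub>\<pi>" 75) where
  "x \<otimes>\<^sub>\<pi> y = embed_tensor (tensor_pure x y)"

lemma bounded_bilinear_proj_pure: "bounded_bilinear (\<otimes>\<^sub>\<pi>)"
proof
  show "\<exists>K. \<forall>(x::'a) (y::'b). norm (x \<otimes>\<^sub>\<pi> y) \<le> norm x * norm y * K"
    by (rule exI[of _ 1]) (simp add: proj_pure_def norm_embed_tensor proj_norm_pure_le)
qed (simp_all add: proj_pure_def tensor_pure_add_left tensor_pure_add_right
    tensor_pure_scaleR_left tensor_pure_scaleR_right embed_tensor_add embed_tensor_scaleR)

end

theory Submission
  imports Defs
begin

text \<open>Write \<open>Z\<close> for the projective tensor product and \<open>T n = x n \<otimes>\<^sub>\<pi> y n\<close>, a sequence in the unit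
  ball of \<open>Z\<close>. The theorem is a fact about such a sequence in an arbitrary Banach space
  (\<open>SSD_convex_series_iff\<close>), read through the isometry between the dual of \<open>Z\<close> and the bounded
  bilinear forms.

  A point \<open>z\<close> of the unit sphere is an SSD point exactly when every functional of the dual ball that
  almost attains the value 1 at \<open>z\<close> is close in norm to one that attains it
  (\<open>SSD_point_imp_near_support\<close> and \<open>near_support_imp_SSD_point\<close>). Now let \<open>z\<close> be a convex series of
  the \<open>T n\<close> with strictly positive weights, and let \<open>f\<close> be in the dual ball. Then \<open>f z\<close> is an average
  of numbers \<open>f (T n) \<le> 1\<close>, so \<open>f z = 1\<close> means \<open>f (T n) = 1\<close> for all \<open>n\<close>, whatever the weights are. In
  the same way, \<open>f z\<close> close to 1 forces finitely many given values \<open>f (T n)\<close> close to 1, because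
  finitely many weights are bounded away from 0; and conversely values close to 1 for \<open>n \<le> k\<close> give
  \<open>f z\<close> close to 1 once the weights after \<open>k\<close> have a small sum. Hence the criterion for one such \<open>z\<close>, the
  criterion for all of them, and the condition on finitely many \<open>f (T n)\<close> coincide.

  The isometry has two halves. A functional on \<open>Z\<close> restricts to elementary tensors, and its norm is
  determined there because finite sums of them are dense and the projective norm is the infimum of
  their costs (\<open>functional_le_on_pure_tensors\<close>). Conversely, a bilinear form factors through the
  algebraic tensor product, where it is dominated by a multiple of the projective norm, and
  therefore extends to the completion (\<open>bilinear_form_extends\<close>).

  The Hahn--Banach theorem enters three times: it provides norming functionals, it splits
  a functional in the SSD criterion, and it extends bilinear forms to the completion.\<close>

section \<open>The Hahn--Banach theorem\<close>

text \<open>A linear functional on a subspace is represented by its graph \<open>G\<close>, an arbitrary subspace of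
  \<open>'v \<times> real\<close> below \<open>p\<close>. Single-valuedness is then automatic: \<open>(0, r) \<in> G\<close> gives \<open>r \<le> p 0 = 0\<close> and
  likewise \<open>- r \<le> 0\<close>. Zorn's lemma applied to such graphs yields a maximal one, and this is total
  because a missing point can be added with a value between the bounds that sublinearity imposes.\<close>

lemma Hahn_Banach_graph:
  fixes p :: "'v::real_vector \<Rightarrow> real" and G :: "('v \<times> real) set"
  assumes add: "\<And>u v. p (u + v) \<le> p u + p v"
    and scale: "\<And>c v. c > 0 \<Longrightarrow> p (c *\<^sub>R v) = c * p v"
    and G: "subspace G" and below: "\<And>v r. (v, r) \<in> G \<Longrightarrow> r \<le> p v"
  obtains F where "linear F" "\<And>v. F v \<le> p v" "\<And>v r. (v, r) \<in> G \<Longrightarrow> F v = r"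
proof -
  define A where "A = {H. subspace H \<and> G \<subseteq> H \<and> (\<forall>v r. (v, r) \<in> H \<longrightarrow> r \<le> p v)}"
  have "G \<in> A"
    using G below by (auto simp: A_def)
  have "\<exists>M\<in>A. \<forall>H\<in>A. M \<subseteq> H \<longrightarrow> H = M"
  proof (rule subset_Zorn_nonempty)
    show "A \<noteq> {}"
      using \<open>G \<in> A\<close> by blast
    fix C assume C: "C \<noteq> {}" "subset.chain A C"
    then have CA: "H \<in> A" if "H \<in> C" for H
      using that by (auto simp: subset.chain_def)
    have "subspace (\<Union>C)"
      unfolding subspace_def
    proof (intro conjI ballI allI)
      show "0 \<in> \<Union>C"
        using C(1) CA by (auto simp: A_def subspace_def)
      show "u + v \<in> \<Union>C" if uv: "u \<in> \<Union>C" "v \<in> \<Union>C" for u v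
      proof -
        obtain H K where HK: "H \<in> C" "u \<in> H" "K \<in> C" "v \<in> K"
          using uv by blast
        then have "H \<subseteq> K \<or> K \<subseteq> H"
          using C(2) by (auto simp: subset.chain_def)
        then obtain L where "L \<in> C" "u \<in> L" "v \<in> L"
          using HK by blast
        then show ?thesis
          using CA[of L] by (auto simp: A_def dest: subspace_add)
      qed
      show "c *\<^sub>R u \<in> \<Union>C" if "u \<in> \<Union>C" for c u
      proof -
        obtain H where "H \<in> C" "u \<in> H"
          using \<open>u \<in> \<Union>C\<close> by blast
        then show ?thesis
          using CA[of H] by (auto simp: A_def dest: subspace_scale)
      qed
    qed
    then show "\<Union>C \<in> A"
      using C(1) CA by (fastforce simp: A_def)
  qed
  then obtain M where M: "subspace M" "G \<subseteq> M" "\<And>v r. (v, r) \<in> M \<Longrightarrow> r \<le> p v"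
    and maximal: "\<And>H. H \<in> A \<Longrightarrow> M \<subseteq> H \<Longrightarrow> H = M"
    by (auto simp: A_def)
  have p0: "p 0 = 0"
    using scale[of 2 0] by simp
  have unique: "r = s" if "(v, r) \<in> M" "(v, s) \<in> M" for v r s
    using M(3)[of 0 "r - s"] M(3)[of 0 "s - r"] subspace_diff[OF M(1) that]
      subspace_diff[OF M(1) that(2,1)] p0 by simp
  have "\<exists>c. (v0, c) \<in> M" for v0
  proof -
    \<comment> \<open>A value \<open>c\<close> at \<open>v0\<close> keeps the graph below \<open>p\<close> iff it lies above every \<open>r - p (v - v0)\<close> and
      below every \<open>p (v + v0) - r\<close>; the supremum of the lower bounds is such a value.\<close>
    define S where "S = (\<lambda>(v, r). r - p (v - v0)) ` M"
    have gap: "r1 - p (v1 - v0) \<le> p (v2 + v0) - r2" if "(v1, r1) \<in> M" "(v2, r2) \<in> M" for v1 r1 v2 r2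
      using M(3)[of "v1 + v2" "r1 + r2"] subspace_add[OF M(1) that] add[of "v1 - v0" "v2 + v0"]
      by simp
    have zero: "(0, 0) \<in> M"
      using subspace_0[OF M(1)] by (simp add: zero_prod_def)
    have "bdd_above S"
      by (rule bdd_aboveI[of _ "p v0"]) (use gap[OF _ zero] in \<open>auto simp: S_def\<close>)
    then have lower: "r - p (v - v0) \<le> Sup S" if "(v, r) \<in> M" for v r
      by (rule cSup_upper[rotated]) (use that in \<open>force simp: S_def\<close>)
    have upper: "Sup S \<le> p (v + v0) - r" if "(v, r) \<in> M" for v r
      by (rule cSup_least) (use zero gap[OF _ that] in \<open>auto simp: S_def\<close>)
    define H where "H = span (insert (v0, Sup S) M)"
    have "r \<le> p v" if vr: "(v, r) \<in> H" for v r
    proof -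
      have "span M = M"
        using M(1) by (simp add: span_eq_iff)
      with vr obtain s where "(v, r) - s *\<^sub>R (v0, Sup S) \<in> M"
        unfolding H_def span_breakdown_eq by metis
      then have s: "(v - s *\<^sub>R v0, r - s * Sup S) \<in> M"
        by simp
      \<comment> \<open>The sign of the coefficient of the new vector decides which bound on its value is used.\<close>
      consider "s = 0" | "s > 0" | "s < 0"
        by linarith
      then show ?thesis
      proof cases
        case 1
        then show ?thesis using s M(3) by simp
      next
        case 2
        have "Sup S \<le> p ((1 / s) *\<^sub>R (v - s *\<^sub>R v0) + v0) - (1 / s) * (r - s * Sup S)"
          using subspace_scale[OF M(1) s, of "1 / s"] by (intro upper) simp
        also have "(1 / s) *\<^sub>R (v - s *\<^sub>R v0) + v0 = (1 / s) *\<^sub>R v"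
          using 2 by (simp add: algebra_simps)
        finally show ?thesis
          using 2 scale[of "1 / s" v] by (simp add: field_simps)
      next
        case 3
        have "(1 / - s) * (r - s * Sup S) - p ((1 / - s) *\<^sub>R (v - s *\<^sub>R v0) - v0) \<le> Sup S"
          using subspace_scale[OF M(1) s, of "1 / - s"] by (intro lower) simp
        also have "(1 / - s) *\<^sub>R (v - s *\<^sub>R v0) - v0 = (1 / - s) *\<^sub>R v"
          using 3 by (simp add: algebra_simps)
        finally show ?thesis
          using 3 scale[of "1 / - s" v] by (simp add: field_simps)
      qed
    qed
    moreover have "M \<subseteq> H"
      unfolding H_def by (auto intro: span_base)
    ultimately have "H = M"
      using M(2) by (intro maximal) (auto simp: A_def H_def)
    then show ?thesis
      unfolding H_def by (metis insertI1 span_base)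
  qed
  then obtain F where F: "\<And>v. (v, F v) \<in> M"
    by metis
  show thesis
  proof
    show "linear F"
    proof (rule linearI)
      show "F (u + v) = F u + F v" for u v
        using subspace_add[OF M(1) F F, of u v] by (intro unique[OF F]) simp
      show "F (c *\<^sub>R v) = c *\<^sub>R F v" for c v
        using subspace_scale[OF M(1) F, of c v] by (intro unique[OF F]) simp
    qed
    show "F v \<le> p v" for v
      by (rule M(3)[OF F])
    show "F v = r" if "(v, r) \<in> G" for v r
      using that M(2) by (intro unique[OF F]) auto
  qed
qed

text \<open>The subspace and the functional on it are given by linear maps \<open>j\<close> and \<open>\<phi>\<close> on a parameter
  space. The map \<open>j\<close> may have a kernel: the domination by \<open>p\<close> forces \<open>\<phi>\<close> to vanish there.\<close>

lemma Hahn_Banach_range: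
  fixes p :: "'v::real_vector \<Rightarrow> real" and j :: "'w::real_vector \<Rightarrow> 'v"
  assumes "\<And>u v. p (u + v) \<le> p u + p v"
    and "\<And>c v. c > 0 \<Longrightarrow> p (c *\<^sub>R v) = c * p v"
    and "linear j" "linear \<phi>" and "\<And>w. \<phi> w \<le> p (j w)"
  obtains F where "linear F" "\<And>v. F v \<le> p v" "\<And>w. F (j w) = \<phi> w"
proof -
  have "linear (\<lambda>w. (j w, \<phi> w))"
    using assms(3,4) by (auto simp: linear_iff)
  then have graph: "subspace (range (\<lambda>w. (j w, \<phi> w)))"
    by (intro linear_subspace_image) auto
  have below: "r \<le> p v" if "(v, r) \<in> range (\<lambda>w. (j w, \<phi> w))" for v r
    using that assms(5) by auto
  show thesis
  proof (rule Hahn_Banach_graph[OF assms(1,2) graph below])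
    fix F assume F: "linear F" "\<And>v. F v \<le> p v"
      "\<And>v r. (v, r) \<in> range (\<lambda>w. (j w, \<phi> w)) \<Longrightarrow> F v = r"
    have "F (j w) = \<phi> w" for w
      by (rule F(3)) auto
    then show thesis
      by (rule that[OF F(1,2)])
  qed
qed

text \<open>A one-sided bound suffices, since replacing \<open>v\<close> by \<open>- v\<close> gives \<open>\<bar>f v\<bar> \<le> norm v\<close>; it is the
  bound that the Hahn--Banach theorem delivers.\<close>

definition dual_ball :: "('v::real_normed_vector \<Rightarrow> real) set" where
  "dual_ball = {f. linear f \<and> (\<forall>v. f v \<le> norm v)}"

lemma linear_abs_le:
  fixes f :: "'v::real_normed_vector \<Rightarrow> real"
  assumes "linear f" "\<And>v. f v \<le> C * norm v"
  shows "\<bar>f v\<bar> \<le> C * norm v"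
  using assms(2)[of v] assms(2)[of "- v"] linear_neg[OF assms(1), of v] by simp

lemma linear_bounded_above_imp_bounded:
  fixes f :: "'v::real_normed_vector \<Rightarrow> real"
  assumes "linear f" "\<And>v. f v \<le> C * norm v"
  shows "bounded_linear f"
  using assms(1) linear_abs_le[OF assms]
  by (intro bounded_linear_intro[of f C]) (auto simp: linear_iff mult.commute)

lemma
  assumes "f \<in> dual_ball"
  shows dual_ball_linear: "linear f" and dual_ball_le: "f v \<le> norm v"
    and dual_ball_bounded_linear: "bounded_linear f"
  using assms linear_bounded_above_imp_bounded[of f 1] by (auto simp: dual_ball_def)

lemma norming_functional:
  fixes z :: "'v::real_normed_vector"
  obtains f where "f \<in> dual_ball" "f z = norm z"
proof -
  obtain f where "linear f" "\<And>v. f v \<le> norm v" "\<And>s. f (s *\<^sub>R z) = s * norm z"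
  proof (rule Hahn_Banach_range[of norm "\<lambda>s. s *\<^sub>R z" "\<lambda>s. s * norm z"])
    show "linear (\<lambda>s. s *\<^sub>R z)" "linear (\<lambda>s. s * norm z)"
      by (auto simp: linear_iff algebra_simps)
    show "s * norm z \<le> norm (s *\<^sub>R z)" for s
      by (simp add: mult_right_mono)
  qed (auto simp: norm_triangle_ineq)
  from this(1,2) this(3)[of 1] show thesis
    by (intro that[of f]) (simp_all add: dual_ball_def)
qed

section \<open>Strong subdifferentiability and the dual ball\<close>

text \<open>The norm is convex, and \<open>z + s *\<^sub>R h\<close> is a convex combination of \<open>z\<close> and \<open>z + t *\<^sub>R h\<close>.\<close>

lemma difference_quotient_mono:
  fixes z h :: "'v::real_normed_vector"
  assumes "0 < s" "s \<le> t"
  shows "(norm (z + s *\<^sub>R h) - norm z) / s \<le> (norm (z + t *\<^sub>R h) - norm z) / t"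
proof -
  have "z + s *\<^sub>R h = (1 - s / t) *\<^sub>R z + (s / t) *\<^sub>R (z + t *\<^sub>R h)"
    using assms by (simp add: algebra_simps)
  then have "norm (z + s *\<^sub>R h) \<le> (1 - s / t) * norm z + (s / t) * norm (z + t *\<^sub>R h)"
    using norm_triangle_ineq[of "(1 - s / t) *\<^sub>R z" "(s / t) *\<^sub>R (z + t *\<^sub>R h)"] assms by simp
  then show ?thesis
    using assms by (simp add: field_simps)
qed

text \<open>Uniformity provides one step \<open>t\<close> at which the difference quotient is within \<open>\<epsilon> / 2\<close> of its limit
  for all directions. A functional with defect at most \<open>\<epsilon> * t / 2\<close> at \<open>z\<close> then stays below the
  one-sided derivative of the norm up to the error \<open>\<epsilon> * norm h\<close>. By Hahn--Banach on \<open>'v \<times> 'v\<close> with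
  the sublinear functional \<open>(a, b) \<mapsto> norm a + \<epsilon> * norm b\<close>, it splits as \<open>g\<close> plus a remainder of norm at
  most \<open>\<epsilon>\<close>. To make \<open>g\<close> attain the value 1 at \<open>z\<close>, the subspace on which the functional is prescribed
  contains the vector \<open>(z, 0)\<close> besides the diagonal.\<close>

lemma SSD_point_imp_near_support:
  fixes z :: "'v::real_normed_vector"
  assumes "SSD_point z" "\<epsilon> > 0"
  obtains \<delta> where "\<delta> > 0"
    "\<And>f. f \<in> dual_ball \<Longrightarrow> f z > 1 - \<delta> \<Longrightarrow> \<exists>g\<in>dual_ball. g z = 1 \<and> (\<forall>h. f h - g h \<le> \<epsilon> * norm h)"
proof -
  define e where "e = \<epsilon> / 2"
  then have "e > 0" using assms by simp
  have z: "norm z = 1"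
    using assms by (simp add: SSD_point_def)
  obtain l where l: "uniform_limit (sphere 0 1) (\<lambda>t h. (norm (z + t *\<^sub>R h) - 1) / t) l (at_right 0)"
    using assms(1) by (auto simp: SSD_point_def)
  have "\<forall>\<^sub>F t in at_right 0. \<forall>h\<in>sphere 0 1. dist ((norm (z + t *\<^sub>R h) - 1) / t) (l h) < e"
    using l \<open>e > 0\<close> by (auto simp: uniform_limit_iff)
  then obtain b where b: "b > 0"
    "\<And>t. 0 < t \<Longrightarrow> t < b \<Longrightarrow> \<forall>h\<in>sphere 0 1. dist ((norm (z + t *\<^sub>R h) - 1) / t) (l h) < e"
    by (auto simp: eventually_at_right_field)
  define t where "t = b / 2"
  have t: "t > 0" "t < b"
    using b(1) by (auto simp: t_def)
  have lt: "(norm (z + t *\<^sub>R h) - 1) / t < l h + e" if "norm h = 1" for h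
    using b(2)[OF t] that by (force simp: dist_real_def)
  have l_le: "l h \<le> (norm (z + s *\<^sub>R h) - 1) / s" if "norm h = 1" "s > 0" for h s
  proof (rule tendsto_upperbound)
    show "((\<lambda>t. (norm (z + t *\<^sub>R h) - 1) / t) \<longlongrightarrow> l h) (at_right 0)"
      using tendsto_uniform_limitI[OF l] that by simp
    show "\<forall>\<^sub>F t in at_right 0. (norm (z + t *\<^sub>R h) - 1) / t \<le> (norm (z + s *\<^sub>R h) - 1) / s"
      unfolding eventually_at_right_field
      using that difference_quotient_mono[of _ s z h] z by (intro exI[of _ s]) auto
  qed simp
  show thesis
  proof
    show "e * t > 0" using t(1) \<open>e > 0\<close> by simp
    fix f :: "'v \<Rightarrow> real" assume f: "f \<in> dual_ball" "f z > 1 - e * t"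
    interpret f: linear f by (rule dual_ball_linear[OF f(1)])
    have f_unit: "f h \<le> (norm (z + s *\<^sub>R h) - 1) / s + 2 * e" if "norm h = 1" "s > 0" for h s
    proof -
      have "f z + t * f h \<le> norm (z + t *\<^sub>R h)"
        using dual_ball_le[OF f(1), of "z + t *\<^sub>R h"] by (simp add: f.add f.scaleR)
      then have "t * f h \<le> t * (l h + e) + e * t"
        using lt[OF that(1)] t f(2) by (simp add: field_simps)
      then have "t * f h \<le> t * (l h + 2 * e)"
        by (simp add: algebra_simps)
      then have "f h \<le> l h + 2 * e"
        using t(1) by simp
      then show ?thesis
        using l_le[OF that] by linarith
    qed
    \<comment> \<open>The domination needed for Hahn--Banach: for \<open>s > 0\<close> and \<open>w \<noteq> 0\<close> it is \<open>f_unit\<close>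
      rescaled; otherwise the triangle inequality is enough.\<close>
    have key: "f w + s \<le> norm (w + s *\<^sub>R z) + 2 * e * norm w" for w s
    proof (cases "s > 0 \<and> w \<noteq> 0")
      case True
      have "f (w /\<^sub>R norm w) \<le> (norm (z + (norm w / s) *\<^sub>R (w /\<^sub>R norm w)) - 1) / (norm w / s) + 2 * e"
        using True by (intro f_unit) auto
      moreover have "norm (w + s *\<^sub>R z) = s * norm (z + (1 / s) *\<^sub>R w)"
      proof -
        have "w + s *\<^sub>R z = s *\<^sub>R (z + (1 / s) *\<^sub>R w)"
          using True by (simp add: scaleR_add_right)
        then show ?thesis
          using True by simp
      qed
      ultimately show ?thesis
        using True by (simp add: f.scaleR field_simps)
    next
      case False
      have "f w + s \<le> norm (w + s *\<^sub>R z)"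
      proof (cases "w = 0")
        case True
        then show ?thesis using z f.zero by simp
      next
        case w: False
        have "norm w + s \<le> norm (w + s *\<^sub>R z)"
          using norm_diff_ineq[of w "s *\<^sub>R z"] w False z by simp
        then show ?thesis
          using dual_ball_le[OF f(1), of w] by linarith
      qed
      then show ?thesis
        using \<open>e > 0\<close> by (smt (verit) mult_nonneg_nonneg norm_ge_zero)
    qed
    define p :: "'v \<times> 'v \<Rightarrow> real" where "p = (\<lambda>(a, b). norm a + 2 * e * norm b)"
    obtain F where F: "linear F" "\<And>v. F v \<le> p v"
      "\<And>w. F (fst w + snd w *\<^sub>R z, fst w) = f (fst w) + snd w"
    proof (rule Hahn_Banach_range[of p "\<lambda>w. (fst w + snd w *\<^sub>R z, fst w)" "\<lambda>w. f (fst w) + snd w"])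
      show "p (u + v) \<le> p u + p v" for u v
      proof -
        have "2 * e * norm (snd u + snd v) \<le> 2 * e * (norm (snd u) + norm (snd v))"
          using \<open>e > 0\<close> by (intro mult_left_mono norm_triangle_ineq) auto
        then show ?thesis
          using norm_triangle_ineq[of "fst u" "fst v"]
          by (simp add: p_def case_prod_beta algebra_simps)
      qed
      show "p (c *\<^sub>R v) = c * p v" if "c > 0" for c v
        using that by (simp add: p_def case_prod_beta algebra_simps)
      show "linear (\<lambda>w::'v \<times> real. (fst w + snd w *\<^sub>R z, fst w))"
        by (auto simp: linear_iff algebra_simps)
      show "linear (\<lambda>w::'v \<times> real. f (fst w) + snd w)"
        by (auto simp: linear_iff f.add f.scaleR algebra_simps)
      show "f (fst w) + snd w \<le> p (fst w + snd w *\<^sub>R z, fst w)" for w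
        using key by (simp add: p_def)
    qed auto
    interpret F: linear F by (rule F(1))
    show "\<exists>g\<in>dual_ball. g z = 1 \<and> (\<forall>h. f h - g h \<le> \<epsilon> * norm h)"
    proof (intro bexI[of _ "\<lambda>a. F (a, 0)"] conjI allI)
      show "F (z, 0) = 1"
        using F(3)[of "(0, 1)"] f.zero by simp
      show "f h - F (h, 0) \<le> \<epsilon> * norm h" for h
      proof -
        have "f h = F (h, 0) + F (0, h)"
          using F(3)[of "(h, 0)"] by (simp flip: F.add)
        then show ?thesis
          using F(2)[of "(0, h)"] by (simp add: p_def e_def)
      qed
      show "(\<lambda>a. F (a, 0)) \<in> dual_ball"
        unfolding dual_ball_def
      proof (intro CollectI conjI allI linearI)
        show "F (a, 0) \<le> norm a" for a
          using F(2)[of "(a, 0)"] by (simp add: p_def)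
        show "F (a + b, 0) = F (a, 0) + F (b, 0)" for a b
          by (simp flip: F.add)
        show "F (c *\<^sub>R a, 0) = c *\<^sub>R F (a, 0)" for c a
          by (subst F.scaleR[symmetric]) simp
      qed
    qed
  qed
qed

text \<open>The limit is the support function \<open>l\<close> of the set \<open>D\<close> of functionals attaining 1 at \<open>z\<close>. It is
  always a lower bound of the difference quotients. A functional that norms \<open>z + t *\<^sub>R h\<close> takes a value
  at least \<open>1 - 2 * t\<close> at \<open>z\<close>, so for small \<open>t\<close>, uniformly in \<open>h\<close>, it is close to some element of \<open>D\<close>; this
  bounds the difference quotient from above.\<close>

lemma near_support_imp_SSD_point:
  fixes z :: "'v::real_normed_vector"
  assumes z: "norm z = 1"
    and near: "\<And>\<epsilon>. \<epsilon> > 0 \<Longrightarrow> \<exists>\<delta>>0. \<forall>f\<in>dual_ball. f z > 1 - \<delta> \<longrightarrow>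
      (\<exists>g\<in>dual_ball. g z = 1 \<and> (\<forall>h. f h - g h \<le> \<epsilon> * norm h))"
  shows "SSD_point z"
  unfolding SSD_point_def
proof (intro conjI z exI)
  define D where "D = {g \<in> dual_ball. g z = 1}"
  define l where "l h = (SUP g\<in>D. g h)" for h
  obtain g0 where "g0 \<in> D"
    using norming_functional[of z] z by (metis (mono_tags, lifting) D_def mem_Collect_eq)
  have bdd: "bdd_above ((\<lambda>g. g h) ` D)" for h
    by (rule bdd_aboveI[of _ "norm h"]) (auto simp: D_def dual_ball_le)
  show "uniform_limit (sphere 0 1) (\<lambda>t h. (norm (z + t *\<^sub>R h) - 1) / t) l (at_right 0)"
    unfolding uniform_limit_iff
  proof (intro allI impI)
    fix e :: real assume "e > 0"
    then obtain \<delta> where \<delta>: "\<delta> > 0" "\<And>f. f \<in> dual_ball \<Longrightarrow> f z > 1 - \<delta> \<Longrightarrow>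
      \<exists>g\<in>dual_ball. g z = 1 \<and> (\<forall>h. f h - g h \<le> e / 2 * norm h)"
      using near[of "e / 2"] by auto
    have "dist ((norm (z + t *\<^sub>R h) - 1) / t) (l h) < e" if t: "0 < t" "t < \<delta> / 2" and h: "norm h = 1" for t h
    proof -
      have "l h \<le> (norm (z + t *\<^sub>R h) - 1) / t"
        unfolding l_def
      proof (rule cSUP_least)
        show "D \<noteq> {}" using \<open>g0 \<in> D\<close> by blast
        show "g h \<le> (norm (z + t *\<^sub>R h) - 1) / t" if "g \<in> D" for g
        proof -
          have g: "g \<in> dual_ball" "g z = 1" using that by (auto simp: D_def)
          show ?thesis
            using dual_ball_le[OF g(1), of "z + t *\<^sub>R h"] t g(2)
            by (simp add: linear_add[OF dual_ball_linear[OF g(1)]]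
                linear_scale[OF dual_ball_linear[OF g(1)]] field_simps)
        qed
      qed
      moreover have "(norm (z + t *\<^sub>R h) - 1) / t \<le> l h + e / 2"
      proof -
        obtain f where f: "f \<in> dual_ball" "f (z + t *\<^sub>R h) = norm (z + t *\<^sub>R h)"
          by (rule norming_functional)
        then have eq: "f z + t * f h = norm (z + t *\<^sub>R h)"
          by (simp add: linear_add[OF dual_ball_linear] linear_scale[OF dual_ball_linear])
        have "t * f h \<le> t"
          using dual_ball_le[OF f(1), of h] h t by simp
        moreover have "1 - t \<le> norm (z + t *\<^sub>R h)"
          using norm_diff_ineq[of z "t *\<^sub>R h"] z h t by simp
        ultimately have "f z > 1 - \<delta>"
          using t eq by linarith
        from \<delta>(2)[OF f(1) this] obtain g where "g \<in> dual_ball" "g z = 1" "f h - g h \<le> e / 2 * norm h"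
          by blast
        then have g: "g \<in> D" "f h - g h \<le> e / 2"
          using h by (simp_all add: D_def)
        have "g h \<le> l h"
          unfolding l_def by (rule cSUP_upper[OF g(1) bdd])
        moreover have "(norm (z + t *\<^sub>R h) - 1) / t \<le> f h"
          using eq dual_ball_le[OF f(1), of z] z t by (simp add: field_simps)
        ultimately show ?thesis
          using g(2) by linarith
      qed
      ultimately show ?thesis
        using \<open>e > 0\<close> by (simp add: dist_real_def)
    qed
    then show "\<forall>\<^sub>F t in at_right 0. \<forall>h\<in>sphere 0 1. dist ((norm (z + t *\<^sub>R h) - 1) / t) (l h) < e"
      unfolding eventually_at_right_field using \<delta>(1) by (intro exI[of _ "\<delta> / 2"]) auto
  qed
qed

section \<open>Duality between the projective tensor product and bilinear forms\<close>

lemma bilin_norm_upper: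
  fixes B :: "'a::real_normed_vector \<Rightarrow> 'b::real_normed_vector \<Rightarrow> real"
  assumes "bounded_bilinear B" "norm a \<le> 1" "norm b \<le> 1"
  shows "\<bar>B a b\<bar> \<le> bilin_norm B"
proof -
  interpret bounded_bilinear B by fact
  obtain K where K: "K \<ge> 0" "\<And>a b. \<bar>B a b\<bar> \<le> norm a * norm b * K"
    using nonneg_bounded by auto
  have "bdd_above ((\<lambda>(a, b). \<bar>B a b\<bar>) ` (cball 0 1 \<times> cball 0 1))"
  proof (rule bdd_aboveI[of _ K], clarsimp)
    fix a :: 'a and b :: 'b assume "norm a \<le> 1" "norm b \<le> 1"
    then have "norm a * norm b * K \<le> 1 * K"
      using K(1) by (intro mult_right_mono mult_le_one) auto
    then show "\<bar>B a b\<bar> \<le> K"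
      using K(2)[of a b] by simp
  qed
  from cSUP_upper[OF _ this, of "(a, b)"] show ?thesis
    using assms(2,3) by (simp add: bilin_norm_def)
qed

lemma bilin_norm_nonneg: "bounded_bilinear B \<Longrightarrow> 0 \<le> bilin_norm B"
  using bilin_norm_upper[of B 0 0] by simp

lemma bilin_norm_bound:
  assumes "bounded_bilinear B"
  shows "\<bar>B u v\<bar> \<le> bilin_norm B * norm u * norm v"
proof -
  interpret bounded_bilinear B by fact
  show ?thesis
  proof (cases "u = 0 \<or> v = 0")
    case True
    then show ?thesis by (auto simp: zero_left zero_right)
  next
    case False
    then show ?thesis
      using bilin_norm_upper[OF assms, of "u /\<^sub>R norm u" "v /\<^sub>R norm v"]
      by (simp add: scaleR_left scaleR_right abs_mult field_simps)
  qed
qed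

lemma bilin_norm_leI:
  fixes B :: "'a::real_normed_vector \<Rightarrow> 'b::real_normed_vector \<Rightarrow> real"
  assumes "\<And>u v. \<bar>B u v\<bar> \<le> C * norm u * norm v" "C \<ge> 0"
  shows "bilin_norm B \<le> C"
  unfolding bilin_norm_def
proof (rule cSUP_least, simp, clarsimp)
  fix a :: 'a and b :: 'b assume "norm a \<le> 1" "norm b \<le> 1"
  then have "C * (norm a * norm b) \<le> C * 1"
    using assms(2) by (intro mult_left_mono mult_le_one) auto
  then show "\<bar>B a b\<bar> \<le> C"
    using assms(1)[of a b] by simp
qed

text \<open>The linear extension of \<open>B\<close> to the free vector space over pairs, of which the algebraic tensor
  product is a quotient.\<close>

definition free_eval :: "('a \<Rightarrow> 'b \<Rightarrow> real) \<Rightarrow> ('a \<times> 'b \<Rightarrow>\<^sub>0 real) \<Rightarrow> real" where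
  "free_eval B u = (\<Sum>q\<in>Poly_Mapping.keys u. Poly_Mapping.lookup u q * B (fst q) (snd q))"

lemma free_eval_superset:
  assumes "finite S" "Poly_Mapping.keys u \<subseteq> S"
  shows "free_eval B u = (\<Sum>q\<in>S. Poly_Mapping.lookup u q * B (fst q) (snd q))"
  unfolding free_eval_def using assms by (intro sum.mono_neutral_left) (auto simp: in_keys_iff)

lemma linear_free_eval: "linear (free_eval B)"
proof (rule linearI)
  fix u v :: "'a \<times> 'b \<Rightarrow>\<^sub>0 real" and c :: real
  let ?S = "Poly_Mapping.keys u \<union> Poly_Mapping.keys v"
  show "free_eval B (u + v) = free_eval B u + free_eval B v"
    using keys_add[of u v]
    by (simp add: free_eval_superset[of ?S] lookup_add sum.distrib algebra_simps)
  have "Poly_Mapping.keys (c *\<^sub>R u) \<subseteq> Poly_Mapping.keys u"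
    by (auto simp: in_keys_iff lookup_scaleR)
  then show "free_eval B (c *\<^sub>R u) = c *\<^sub>R free_eval B u"
    by (simp add: free_eval_superset[of "Poly_Mapping.keys u"] lookup_scaleR sum_distrib_left
        mult.assoc)
qed

lemma free_eval_single: "free_eval B (Poly_Mapping.single (a, b) 1) = B a b"
  by (simp add: free_eval_def)

lemma free_eval_relators:
  fixes B :: "'a::real_vector \<Rightarrow> 'b::real_vector \<Rightarrow> real"
  assumes B: "bilinear B" and u: "u \<in> span tensor_relators"
  shows "free_eval B u = 0"
proof (rule linear_eq_0_on_span[OF linear_free_eval _ u])
  fix v :: "'a \<times> 'b \<Rightarrow>\<^sub>0 real" assume "v \<in> tensor_relators"
  then show "free_eval B v = 0"
    unfolding tensor_relators_def Let_def
    by (elim UnE CollectE exE conjE; hypsubst)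
      (simp_all add: linear_diff[OF linear_free_eval] linear_scale[OF linear_free_eval]
        free_eval_single bilinear_ladd[OF B] bilinear_radd[OF B] bilinear_lmul[OF B]
        bilinear_rmul[OF B])
qed

lemma alg_tensor_lift:
  assumes B: "bilinear B"
  obtains \<beta> :: "('a::real_vector, 'b::real_vector) alg_tensor \<Rightarrow> real"
  where "linear \<beta>" "\<And>u v. \<beta> (tensor_pure u v) = B u v"
proof
  define \<beta> where "\<beta> w = free_eval B (rep_alg_tensor w)" for w
  have abs: "\<beta> (abs_alg_tensor u) = free_eval B u" for u
  proof -
    have "rep_alg_tensor (abs_alg_tensor u) - u \<in> span tensor_relators"
      using Quotient3_rep_abs[OF Quotient3_alg_tensor, of u] by (simp add: span_zero)
    from free_eval_relators[OF B this] show ?thesis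
      by (simp add: \<beta>_def linear_diff[OF linear_free_eval])
  qed
  have rep: "\<exists>u. w = abs_alg_tensor u" for w :: "('a, 'b) alg_tensor"
    by (metis Quotient3_abs_rep[OF Quotient3_alg_tensor])
  show "linear \<beta>"
  proof (rule linearI)
    fix w w' :: "('a, 'b) alg_tensor" and c :: real
    obtain u u' where "w = abs_alg_tensor u" "w' = abs_alg_tensor u'"
      using rep by blast
    then show "\<beta> (w + w') = \<beta> w + \<beta> w'" "\<beta> (c *\<^sub>R w) = c *\<^sub>R \<beta> w"
      by (simp_all add: plus_alg_tensor.abs_eq scaleR_alg_tensor.abs_eq abs
          linear_add[OF linear_free_eval] linear_scale[OF linear_free_eval])
  qed
  show "\<beta> (tensor_pure a b) = B a b" for a b
    by (simp add: tensor_pure.abs_eq abs free_eval_single)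
qed

text \<open>The bound on elementary tensors passes to every representation of \<open>w\<close> as a finite sum, hence to
  the infimum of the costs.\<close>

lemma linear_le_proj_norm:
  assumes "linear \<beta>" "\<And>u v. \<beta> (tensor_pure u v) \<le> C * (norm u * norm v)" "C \<ge> 0"
  shows "\<beta> w \<le> C * proj_norm w"
proof -
  have cost: "\<beta> w \<le> C * r" if r: "r \<in> proj_costs w" for r
  proof -
    obtain k :: nat and a b where w: "w = (\<Sum>i<k. tensor_pure (a i) (b i))"
      and r: "r = (\<Sum>i<k. norm (a i) * norm (b i))"
      using r unfolding proj_costs_def by blast
    show ?thesis
      unfolding w r linear_sum[OF assms(1)] sum_distrib_left by (intro sum_mono assms(2))
  qed
  show ?thesis
  proof (cases "C = 0")
    case True
    then show ?thesis
      using cost proj_costs_nonempty[of w] by auto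
  next
    case False
    then have "\<beta> w / C \<le> proj_norm w"
      unfolding proj_norm_def using cost proj_costs_nonempty assms(3)
      by (intro cInf_greatest) (auto simp: field_simps)
    then show ?thesis
      using False assms(3) by (simp add: field_simps)
  qed
qed

lemma linear_embed_tensor: "linear embed_tensor"
  by (rule linearI) (simp_all add: embed_tensor_add embed_tensor_scaleR)

text \<open>The linear form \<open>\<beta>\<close> that \<open>B\<close> induces on the algebraic tensor product is carried to the completion
  by Hahn--Banach along \<^const>\<open>embed_tensor\<close>. This gives the extension and its norm bound in one step,
  without a limit along Cauchy sequences.\<close>

lemma bilinear_form_extends:
  assumes B: "bounded_bilinear B" and le: "bilin_norm B \<le> C"
  obtains F where "linear F" "\<And>z. F z \<le> C * norm z" "\<And>u v. F (u \<otimes>\<^sub>\<pi> v) = B u v"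
proof -
  have "bilinear B"
    using B by (simp add: bilinear_def linear_iff bounded_bilinear.add_left bounded_bilinear.add_right
        bounded_bilinear.scaleR_left bounded_bilinear.scaleR_right)
  from alg_tensor_lift[OF this]
  obtain \<beta> where \<beta>: "linear \<beta>" "\<And>u v. \<beta> (tensor_pure u v) = B u v"
    by blast
  have bound: "\<bar>B u v\<bar> \<le> C * (norm u * norm v)" for u v
    using bilin_norm_bound[OF B, of u v] mult_right_mono[OF le, of "norm u * norm v"]
    by (simp add: mult.assoc)
  have C: "C \<ge> 0"
    using bilin_norm_nonneg[OF B] le by simp
  obtain F where "linear F" "\<And>z. F z \<le> C * norm z" "\<And>w. F (embed_tensor w) = \<beta> w"
  proof (rule Hahn_Banach_range[of "\<lambda>z. C * norm z" embed_tensor \<beta>])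
    show "C * norm (u + v) \<le> C * norm u + C * norm v" for u v :: "('a, 'b) proj_tensor"
      using mult_left_mono[OF norm_triangle_ineq C, of u v] by (simp add: distrib_left)
    show "\<beta> w \<le> C * norm (embed_tensor w)" for w
      unfolding norm_embed_tensor
      by (rule linear_le_proj_norm) (use \<beta> C abs_le_D1[OF bound] in auto)
  qed (auto intro: linear_embed_tensor \<beta>(1))
  then show thesis
    using that[of F] \<beta>(2) by (simp add: proj_pure_def)
qed

text \<open>This makes the passage from functionals to forms isometric: the bound extends to finite sums by
  the definition of the projective norm, and to the completion by density.\<close>

lemma functional_le_on_pure_tensors:
  assumes D: "bounded_linear D" and pure: "\<And>u v. D (u \<otimes>\<^sub>\<pi> v) \<le> C * (norm u * norm v)"
    and C: "C \<ge> 0"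
  shows "D z \<le> C * norm z"
proof -
  interpret D: bounded_linear D by fact
  have embedded: "D (embed_tensor w) \<le> C * norm (embed_tensor w)" for w
    unfolding norm_embed_tensor
    using linear_le_proj_norm[OF linear_compose[OF linear_embed_tensor D.linear], of C w] pure C
    by (simp add: o_def proj_pure_def)
  have "\<exists>w. dist (embed_tensor w) z < inverse (real (Suc n))" for n
    by (rule embed_tensor_dense[of "inverse (real (Suc n))" z]) auto
  then obtain w where w: "\<And>n. dist (embed_tensor (w n)) z < inverse (real (Suc n))"
    by metis
  have "(\<lambda>n. dist (embed_tensor (w n)) z) \<longlonglongrightarrow> 0"
    by (rule tendsto_sandwich[OF _ _ tendsto_const LIMSEQ_inverse_real_of_nat])
      (auto intro!: always_eventually less_imp_le w simp del: of_nat_Suc)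
  then have lim: "(\<lambda>n. embed_tensor (w n)) \<longlonglongrightarrow> z"
    by (rule tendsto_dist_iff[THEN iffD2])
  show ?thesis
    by (rule LIMSEQ_le[OF D.tendsto[OF lim] tendsto_mult_left[OF tendsto_norm[OF lim]]])
      (use embedded in auto)
qed

definition form_of ::
  "(('a::real_normed_vector, 'b::real_normed_vector) proj_tensor \<Rightarrow> real) \<Rightarrow> 'a \<Rightarrow> 'b \<Rightarrow> real"
where
  "form_of F u v = F (u \<otimes>\<^sub>\<pi> v)"

lemma norm_proj_pure_le: "norm (u \<otimes>\<^sub>\<pi> v) \<le> norm u * norm v"
  by (simp add: proj_pure_def norm_embed_tensor proj_norm_pure_le)

lemma bounded_bilinear_form_of:
  assumes "bounded_linear F"
  shows "bounded_bilinear (form_of F)"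
proof -
  interpret F: bounded_linear F by fact
  interpret P: bounded_bilinear "(\<otimes>\<^sub>\<pi>)" by (rule bounded_bilinear_proj_pure)
  obtain K where K: "K \<ge> 0" "\<And>z. norm (F z) \<le> norm z * K"
    using F.nonneg_bounded by blast
  show ?thesis
  proof
    show "\<exists>K. \<forall>u v. norm (form_of F u v) \<le> norm u * norm v * K"
      unfolding form_of_def
      using K(2) mult_right_mono[OF norm_proj_pure_le K(1)] by (meson order_trans)
  qed (simp_all add: form_of_def P.add_left P.add_right P.scaleR_left P.scaleR_right F.add F.scaleR)
qed

lemma bilin_norm_form_of_le:
  assumes "linear F" "\<And>z. F z \<le> C * norm z" "C \<ge> 0"
  shows "bilin_norm (form_of F) \<le> C"
proof (rule bilin_norm_leI)
  show "\<bar>form_of F u v\<bar> \<le> C * norm u * norm v" for u v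
    using linear_abs_le[OF assms(1,2), of "u \<otimes>\<^sub>\<pi> v"]
      mult_left_mono[OF norm_proj_pure_le assms(3), of u v]
    by (simp add: form_of_def mult.assoc)
qed fact

section \<open>Convex series of elementary tensors\<close>

text \<open>Every summand of \<open>1 - s = (\<Sum>n. \<mu> n * (1 - a n))\<close> is nonnegative.\<close>

lemma convex_series_defect:
  fixes \<mu> a :: "nat \<Rightarrow> real"
  assumes "\<And>n. \<mu> n \<ge> 0" "\<mu> sums 1" "\<And>n. a n \<le> 1" "(\<lambda>n. \<mu> n * a n) sums s"
  shows "\<mu> m * (1 - a m) \<le> 1 - s"
proof -
  have "(\<lambda>n. \<mu> n * (1 - a n)) sums (1 - s)"
    using sums_diff[OF assms(2,4)] by (simp add: algebra_simps)
  then show ?thesis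
    using sum_le_suminf[of "\<lambda>n. \<mu> n * (1 - a n)" "{m}"] assms(1,3)
    by (auto simp: sums_iff)
qed

text \<open>Choose \<open>k\<close> such that the weights after \<open>k\<close> add up to less than \<open>\<delta> / 4\<close>. The values there are only
  known to be at least \<open>- 1\<close>, so they can lower the sum by at most \<open>\<delta> / 2\<close>. The pair \<open>k\<close>, \<open>\<eta>\<close> depends on
  the weights only, not on the sequence \<open>a\<close>.\<close>

lemma convex_series_lower_bound:
  fixes \<mu> a :: "nat \<Rightarrow> real"
  assumes \<mu>: "\<And>n. \<mu> n \<ge> 0" "\<mu> sums 1" and "\<delta> > 0"
  obtains k \<eta> where "\<eta> > 0"
    "\<And>a s. \<lbrakk>\<And>n. \<bar>a n\<bar> \<le> 1; \<And>n. n \<le> k \<Longrightarrow> a n > 1 - \<eta>; (\<lambda>n. \<mu> n * a n) sums s\<rbrakk> \<Longrightarrow> s > 1 - \<delta>"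
proof -
  have "(\<lambda>k. \<Sum>n\<le>k. \<mu> n) \<longlonglongrightarrow> 1"
    using \<mu>(2) by (simp add: sums_def_le)
  then obtain k where k: "(\<Sum>n\<le>k. \<mu> n) > 1 - \<delta> / 4"
    using order_tendstoD(1)[of _ 1 sequentially "1 - \<delta> / 4"] \<open>\<delta> > 0\<close>
    by (auto simp: eventually_sequentially)
  have "s > 1 - \<delta>" if a: "\<And>n. \<bar>a n\<bar> \<le> 1" "\<And>n. n \<le> k \<Longrightarrow> a n > 1 - \<delta> / 4" "(\<lambda>n. \<mu> n * a n) sums s" for a s
  proof -
    \<comment> \<open>Adding 1 makes all terms nonnegative, so that the sum can be cut off at \<open>k\<close>.\<close>
    have nonneg: "0 \<le> \<mu> n * (1 + a n)" for n
      using \<mu>(1) a(1)[of n] by (intro mult_nonneg_nonneg) auto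
    have "(\<lambda>n. \<mu> n * (1 + a n)) sums (1 + s)"
      using sums_add[OF \<mu>(2) a(3)] by (simp add: algebra_simps)
    then have "(\<Sum>n\<le>k. \<mu> n * (1 + a n)) \<le> 1 + s"
      using sum_le_suminf[of "\<lambda>n. \<mu> n * (1 + a n)" "{..k}"] nonneg by (auto simp: sums_iff)
    moreover have "(\<Sum>n\<le>k. \<mu> n) * (2 - \<delta> / 4) \<le> (\<Sum>n\<le>k. \<mu> n * (1 + a n))"
      unfolding sum_distrib_right by (intro sum_mono mult_left_mono \<mu>(1)) (use a(2) in force)
    moreover have "(\<Sum>n\<le>k. \<mu> n) * (\<delta> / 4) \<le> 1 * (\<delta> / 4)"
      using sum_le_suminf[of \<mu> "{..k}"] \<mu> \<open>\<delta> > 0\<close>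
      by (intro mult_right_mono) (auto simp: sums_iff)
    ultimately show ?thesis
      using k \<open>\<delta> > 0\<close> unfolding right_diff_distrib by linarith
  qed
  then show thesis
    using \<open>\<delta> > 0\<close> by (intro that[of "\<delta> / 4" k]) auto
qed

lemma convex_series:
  fixes T :: "nat \<Rightarrow> 'v::banach"
  assumes T: "\<And>n. norm (T n) \<le> 1" and \<mu>: "\<And>n. \<mu> n \<ge> 0" "\<mu> sums 1"
  shows convex_series_summable: "summable (\<lambda>n. \<mu> n *\<^sub>R T n)"
    and convex_series_norm_le: "norm (suminf (\<lambda>n. \<mu> n *\<^sub>R T n)) \<le> 1"
proof -
  have le: "norm (\<mu> n *\<^sub>R T n) \<le> \<mu> n" for n
    using mult_left_mono[OF T \<mu>(1), of n n] \<mu>(1)[of n] by simp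
  show sm: "summable (\<lambda>n. \<mu> n *\<^sub>R T n)"
    by (rule summable_comparison_test'[OF sums_summable[OF \<mu>(2)]]) (rule le)
  show "norm (suminf (\<lambda>n. \<mu> n *\<^sub>R T n)) \<le> 1"
    using norm_suminf_le[OF le sums_summable[OF \<mu>(2)]] sums_unique[OF \<mu>(2)] by simp
qed

lemma dual_ball_convex_series:
  assumes "f \<in> dual_ball" "summable (\<lambda>n. \<mu> n *\<^sub>R T n)"
  shows "(\<lambda>n. \<mu> n * f (T n)) sums f (suminf (\<lambda>n. \<mu> n *\<^sub>R T n))"
  using bounded_linear.sums[OF dual_ball_bounded_linear[OF assms(1)] summable_sums[OF assms(2)]]
  by (simp add: linear_scale[OF dual_ball_linear[OF assms(1)]])

text \<open>The right-hand side does not mention the weights: all convex series with positive weights are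
  supported by the same functionals.\<close>

lemma supports_convex_series_iff:
  fixes T :: "nat \<Rightarrow> 'v::banach"
  assumes T: "\<And>n. norm (T n) \<le> 1" and \<mu>: "\<And>n. \<mu> n > 0" "\<mu> sums 1" and f: "f \<in> dual_ball"
  shows "f (suminf (\<lambda>n. \<mu> n *\<^sub>R T n)) = 1 \<longleftrightarrow> (\<forall>n. f (T n) = 1)"
proof
  have series: "(\<lambda>n. \<mu> n * f (T n)) sums f (suminf (\<lambda>n. \<mu> n *\<^sub>R T n))"
    using \<mu> by (intro dual_ball_convex_series f convex_series_summable T) (auto simp: less_imp_le)
  have le1: "f (T n) \<le> 1" for n
    using dual_ball_le[OF f, of "T n"] T[of n] by linarith
  show "\<forall>n. f (T n) = 1" if "f (suminf (\<lambda>n. \<mu> n *\<^sub>R T n)) = 1"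
  proof
    fix n
    have "\<mu> n * (1 - f (T n)) \<le> 0"
      using convex_series_defect[OF _ \<mu>(2) le1 series, of n] \<mu>(1) that by (simp add: less_imp_le)
    then show "f (T n) = 1"
      using \<mu>(1)[of n] le1[of n] by (simp add: mult_le_0_iff)
  qed
  show "f (suminf (\<lambda>n. \<mu> n *\<^sub>R T n)) = 1" if "\<forall>n. f (T n) = 1"
    using series that \<mu>(2) by (simp add: sums_unique2)
qed

text \<open>In the forward direction the weights \<open>1 / 2 ^ Suc n\<close> suffice. In the backward direction the minimum
  of the weights \<open>\<mu> 0, \<dots>, \<mu> k\<close> turns a small defect of
  \<open>f\<close> at the convex series into small defects at \<open>T 0, \<dots>, T k\<close>. The functional \<open>g0\<close> ensures that all
  the convex series have norm one.\<close>

lemma SSD_convex_series_iff: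
  fixes T :: "nat \<Rightarrow> 'v::banach"
  assumes T: "\<And>n. norm (T n) \<le> 1" and g0: "g0 \<in> dual_ball" "\<And>n. g0 (T n) = 1"
  shows "(\<forall>\<mu>. (\<forall>n. \<mu> n \<in> {0<..1}) \<and> \<mu> sums 1 \<longrightarrow> SSD_point (suminf (\<lambda>n. \<mu> n *\<^sub>R T n))) \<longleftrightarrow>
    (\<forall>\<epsilon>>0. \<exists>k. \<exists>\<eta>>0. \<forall>f\<in>dual_ball. (\<forall>n\<le>k. f (T n) > 1 - \<eta>) \<longrightarrow>
      (\<exists>g\<in>dual_ball. (\<forall>n. g (T n) = 1) \<and> (\<forall>h. f h - g h \<le> \<epsilon> * norm h)))"
proof (intro iffI allI impI)
  assume SSD: "\<forall>\<mu>. (\<forall>n. \<mu> n \<in> {0<..1}) \<and> \<mu> sums 1 \<longrightarrow> SSD_point (suminf (\<lambda>n. \<mu> n *\<^sub>R T n))"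
  fix \<epsilon> :: real assume "\<epsilon> > 0"
  define \<mu> :: "nat \<Rightarrow> real" where "\<mu> n = (1 / 2) ^ Suc n" for n
  have \<mu>: "\<And>n. \<mu> n > 0" "\<mu> sums 1" "\<And>n. \<mu> n \<le> 1"
    using power_half_series power_le_one[of "1 / 2 :: real"]
    by (auto simp: \<mu>_def[abs_def] simp del: power_Suc)
  let ?z = "suminf (\<lambda>n. \<mu> n *\<^sub>R T n)"
  have "SSD_point ?z"
    using SSD \<mu> by simp
  from SSD_point_imp_near_support[OF this \<open>\<epsilon> > 0\<close>]
  obtain \<delta> where \<delta>: "\<delta> > 0" "\<And>f. f \<in> dual_ball \<Longrightarrow> f ?z > 1 - \<delta> \<Longrightarrow>
      \<exists>g\<in>dual_ball. g ?z = 1 \<and> (\<forall>h. f h - g h \<le> \<epsilon> * norm h)"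
    by blast
  obtain k \<eta> where k: "\<eta> > 0" "\<And>a s. \<lbrakk>\<And>n. \<bar>a n\<bar> \<le> 1; \<And>n. n \<le> k \<Longrightarrow> a n > 1 - \<eta>;
      (\<lambda>n. \<mu> n * a n) sums s\<rbrakk> \<Longrightarrow> s > 1 - \<delta>"
    by (rule convex_series_lower_bound[OF less_imp_le[OF \<mu>(1)] \<mu>(2) \<delta>(1)]) blast
  show "\<exists>k. \<exists>\<eta>>0. \<forall>f\<in>dual_ball. (\<forall>n\<le>k. f (T n) > 1 - \<eta>) \<longrightarrow>
      (\<exists>g\<in>dual_ball. (\<forall>n. g (T n) = 1) \<and> (\<forall>h. f h - g h \<le> \<epsilon> * norm h))"
  proof (intro exI[of _ k] exI[of _ \<eta>] conjI ballI impI k(1))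
    fix f assume f: "f \<in> dual_ball" "\<forall>n\<le>k. f (T n) > 1 - \<eta>"
    have "\<bar>f (T n)\<bar> \<le> 1" for n
      using linear_abs_le[OF dual_ball_linear[OF f(1)], of 1 "T n"] dual_ball_le[OF f(1)] T[of n]
      by simp
    then have "f ?z > 1 - \<delta>"
      using f(2) by (intro k(2)[OF _ _ dual_ball_convex_series[OF f(1)]]
          convex_series_summable T less_imp_le[OF \<mu>(1)] \<mu>(2)) auto
    from \<delta>(2)[OF f(1) this]
    show "\<exists>g\<in>dual_ball. (\<forall>n. g (T n) = 1) \<and> (\<forall>h. f h - g h \<le> \<epsilon> * norm h)"
      using supports_convex_series_iff[where T = T, OF T \<mu>(1,2)] by blast
  qed
next
  assume near: "\<forall>\<epsilon>>0. \<exists>k. \<exists>\<eta>>0. \<forall>f\<in>dual_ball. (\<forall>n\<le>k. f (T n) > 1 - \<eta>) \<longrightarrow>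
      (\<exists>g\<in>dual_ball. (\<forall>n. g (T n) = 1) \<and> (\<forall>h. f h - g h \<le> \<epsilon> * norm h))"
  fix \<mu> :: "nat \<Rightarrow> real" assume "(\<forall>n. \<mu> n \<in> {0<..1}) \<and> \<mu> sums 1"
  then have \<mu>: "\<And>n. \<mu> n > 0" "\<mu> sums 1" and \<mu>0: "\<And>n. \<mu> n \<ge> 0"
    by (auto simp: less_imp_le)
  let ?z = "suminf (\<lambda>n. \<mu> n *\<^sub>R T n)"
  show "SSD_point ?z"
  proof (rule near_support_imp_SSD_point)
    have "g0 ?z = 1"
      using supports_convex_series_iff[where T = T, OF T \<mu> g0(1)] g0(2) by simp
    then show "norm ?z = 1"
      using dual_ball_le[OF g0(1), of ?z] convex_series_norm_le[where T = T, OF T \<mu>0 \<mu>(2)] by simp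
    fix \<epsilon> :: real assume "\<epsilon> > 0"
    then obtain k \<eta> where k: "\<eta> > 0" "\<And>f. f \<in> dual_ball \<Longrightarrow> (\<forall>n\<le>k. f (T n) > 1 - \<eta>) \<Longrightarrow>
      \<exists>g\<in>dual_ball. (\<forall>n. g (T n) = 1) \<and> (\<forall>h. f h - g h \<le> \<epsilon> * norm h)"
      using near by metis
    define m where "m = Min (\<mu> ` {..k})"
    have m: "m > 0" "\<And>n. n \<le> k \<Longrightarrow> m \<le> \<mu> n"
      using \<mu>(1) by (auto simp: m_def)
    show "\<exists>\<delta>>0. \<forall>f\<in>dual_ball. f ?z > 1 - \<delta> \<longrightarrow>
      (\<exists>g\<in>dual_ball. g ?z = 1 \<and> (\<forall>h. f h - g h \<le> \<epsilon> * norm h))"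
    proof (intro exI[of _ "m * \<eta>"] conjI ballI impI)
      show "m * \<eta> > 0" using m(1) k(1) by simp
      fix f assume f: "f \<in> dual_ball" "f ?z > 1 - m * \<eta>"
      have le1: "f (T n) \<le> 1" for n
        using dual_ball_le[OF f(1), of "T n"] T[of n] by linarith
      have "f (T n) > 1 - \<eta>" if "n \<le> k" for n
      proof -
        have "\<mu> n * (1 - f (T n)) \<le> 1 - f ?z"
          by (intro convex_series_defect[where a = "\<lambda>n. f (T n)"] \<mu>0 \<mu>(2) le1
              dual_ball_convex_series f(1) convex_series_summable T)
        also have "\<dots> < m * \<eta>"
          using f(2) by simp
        also have "\<dots> \<le> \<mu> n * \<eta>"
          using m(2)[OF that] k(1) by (simp add: mult_right_mono)
        finally show ?thesis
          using \<mu>(1)[of n] by simp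
      qed
      then show "\<exists>g\<in>dual_ball. g ?z = 1 \<and> (\<forall>h. f h - g h \<le> \<epsilon> * norm h)"
        using k(2)[OF f(1)] supports_convex_series_iff[where T = T, OF T \<mu>] by blast
    qed
  qed
qed

section \<open>The equivalence for bilinear forms\<close>

lemma dual_ball_form_of:
  assumes "F \<in> dual_ball"
  shows "bounded_bilinear (form_of F)" "bilin_norm (form_of F) \<le> 1"
  using bounded_bilinear_form_of[OF dual_ball_bounded_linear[OF assms]]
    bilin_norm_form_of_le[OF dual_ball_linear[OF assms], of 1] dual_ball_le[OF assms] by auto

lemma bilinear_form_in_dual_ball:
  assumes "bounded_bilinear B" "bilin_norm B \<le> 1"
  obtains F where "F \<in> dual_ball" "form_of F = B"
proof -
  obtain F where F: "linear F" "\<And>z. F z \<le> 1 * norm z" "\<And>u v. F (u \<otimes>\<^sub>\<pi> v) = B u v"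
    by (rule bilinear_form_extends[OF assms]) blast
  show thesis
    by (rule that[of F]) (use F in \<open>auto simp: dual_ball_def form_of_def fun_eq_iff\<close>)
qed

lemma bilin_norm_eq_1:
  assumes "bounded_bilinear B" "bilin_norm B \<le> 1" "norm u \<le> 1" "norm v \<le> 1" "B u v = 1"
  shows "bilin_norm B = 1"
  using bilin_norm_upper[OF assms(1,3,4)] assms(2,5) by simp

text \<open>The conversion between functionals and forms loses nothing, except that the strict bound on
  \<^const>\<open>bilin_norm\<close> is reached from the non-strict one by passing to \<open>\<epsilon> / 2\<close>.\<close>

theorem theorem3p11:
  fixes x :: "nat \<Rightarrow> 'a::banach" and y :: "nat \<Rightarrow> 'b::banach"
  assumes "\<And>n. x n \<in> sphere 0 1" and "\<And>n. y n \<in> sphere 0 1"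
  shows
    "(norm (suminf (\<lambda>n. (1 / 2 ^ Suc n) *\<^sub>R (x n \<otimes>\<^sub>\<pi> y n))) = 1 \<longleftrightarrow>
        (\<exists>V. bounded_bilinear V \<and> bilin_norm V = 1 \<and> (\<forall>n. V (x n) (y n) = 1)))
     \<and>
     (norm (suminf (\<lambda>n. (1 / 2 ^ Suc n) *\<^sub>R (x n \<otimes>\<^sub>\<pi> y n))) = 1 \<longrightarrow>
        ((\<forall>\<mu> :: nat \<Rightarrow> real. (\<forall>n. \<mu> n \<in> {0<..1}) \<and> \<mu> sums 1 \<longrightarrow>
            SSD_point (suminf (\<lambda>n. \<mu> n *\<^sub>R (x n \<otimes>\<^sub>\<pi> y n))))
         \<longleftrightarrow>
         (\<forall>\<epsilon>>0. \<exists>k. \<exists>\<eta>>0. \<forall>B.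
            bounded_bilinear B \<and> bilin_norm B \<le> 1 \<and> (\<forall>n\<le>k. B (x n) (y n) > 1 - \<eta>) \<longrightarrow>
            (\<exists>B'. bounded_bilinear B' \<and> bilin_norm B' = 1 \<and>
                  bilin_norm (\<lambda>u v. B u v - B' u v) < \<epsilon> \<and>
                  (\<forall>n. B' (x n) (y n) = 1)))))"
proof (intro conjI impI)
  have unit: "norm (x n) = 1" "norm (y n) = 1" for n
    using assms by auto
  define T where "T n = x n \<otimes>\<^sub>\<pi> y n" for n
  have T: "norm (T n) \<le> 1" for n
    using norm_proj_pure_le[of "x n" "y n"] unit by (simp add: T_def)
  have form_T: "form_of F (x n) (y n) = F (T n)" for F n
    by (simp add: form_of_def T_def)
  define \<mu> :: "nat \<Rightarrow> real" where "\<mu> n = 1 / 2 ^ Suc n" for n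
  have \<mu>: "\<And>n. \<mu> n > 0" "\<mu> sums 1"
    using power_half_series by (auto simp: \<mu>_def[abs_def] power_one_over)
  let ?z = "suminf (\<lambda>n. \<mu> n *\<^sub>R T n)"
  have z: "suminf (\<lambda>n. (1 / 2 ^ Suc n) *\<^sub>R (x n \<otimes>\<^sub>\<pi> y n)) = ?z"
    by (simp add: \<mu>_def T_def)
  note supports = supports_convex_series_iff[where T = T, OF T \<mu>]
  show equiv: "norm (suminf (\<lambda>n. (1 / 2 ^ Suc n) *\<^sub>R (x n \<otimes>\<^sub>\<pi> y n))) = 1 \<longleftrightarrow>
        (\<exists>V. bounded_bilinear V \<and> bilin_norm V = 1 \<and> (\<forall>n. V (x n) (y n) = 1))"
    unfolding z
  proof
    assume "norm ?z = 1"
    then obtain F where F: "F \<in> dual_ball" "F ?z = 1"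
      using norming_functional[of ?z] by auto
    then have "form_of F (x n) (y n) = 1" for n
      using supports by (simp add: form_T)
    then show "\<exists>V. bounded_bilinear V \<and> bilin_norm V = 1 \<and> (\<forall>n. V (x n) (y n) = 1)"
      using dual_ball_form_of[OF F(1)] bilin_norm_eq_1[of _ "x 0" "y 0"] unit
      by (intro exI[of _ "form_of F"]) auto
  next
    assume "\<exists>V. bounded_bilinear V \<and> bilin_norm V = 1 \<and> (\<forall>n. V (x n) (y n) = 1)"
    then obtain V where V: "bounded_bilinear V" "bilin_norm V \<le> 1" "\<And>n. V (x n) (y n) = 1"
      by auto
    obtain F where F: "F \<in> dual_ball" "form_of F = V"
      by (rule bilinear_form_in_dual_ball[OF V(1,2)])
    then have "F ?z = 1"
      using supports V(3) by (simp add: form_T[symmetric])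
    then show "norm ?z = 1"
      using dual_ball_le[OF F(1), of ?z] convex_series_norm_le[where T = T, OF T less_imp_le[OF \<mu>(1)] \<mu>(2)]
      by simp
  qed
  assume "norm (suminf (\<lambda>n. (1 / 2 ^ Suc n) *\<^sub>R (x n \<otimes>\<^sub>\<pi> y n))) = 1"
  then obtain g0 where g0: "g0 \<in> dual_ball" "g0 ?z = 1"
    unfolding z using norming_functional[of ?z] by auto
  then have g0_T: "g0 (T n) = 1" for n
    using supports by simp
  let ?near = "\<lambda>\<epsilon>. \<exists>k. \<exists>\<eta>>0. \<forall>f\<in>dual_ball. (\<forall>n\<le>k. f (T n) > 1 - \<eta>) \<longrightarrow>
      (\<exists>g\<in>dual_ball. (\<forall>n. g (T n) = 1) \<and> (\<forall>h. f h - g h \<le> \<epsilon> * norm h))"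
  let ?near_form = "\<lambda>\<epsilon>. \<exists>k. \<exists>\<eta>>0. \<forall>B.
      bounded_bilinear B \<and> bilin_norm B \<le> 1 \<and> (\<forall>n\<le>k. B (x n) (y n) > 1 - \<eta>) \<longrightarrow>
      (\<exists>B'. bounded_bilinear B' \<and> bilin_norm B' = 1 \<and>
            bilin_norm (\<lambda>u v. B u v - B' u v) < \<epsilon> \<and> (\<forall>n. B' (x n) (y n) = 1))"
  have to_form: "?near_form \<epsilon>" if \<epsilon>: "\<epsilon> > 0" and near: "?near (\<epsilon> / 2)" for \<epsilon>
  proof -
    obtain k \<eta> where k: "\<eta> > 0" "\<And>f. f \<in> dual_ball \<Longrightarrow> \<forall>n\<le>k. f (T n) > 1 - \<eta> \<Longrightarrow>
        \<exists>g\<in>dual_ball. (\<forall>n. g (T n) = 1) \<and> (\<forall>h. f h - g h \<le> \<epsilon> / 2 * norm h)"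
      using near by blast
    show ?thesis
    proof (intro exI[of _ k] exI[of _ \<eta>] conjI k(1) allI impI)
      fix B :: "'a \<Rightarrow> 'b \<Rightarrow> real"
      assume B: "bounded_bilinear B \<and> bilin_norm B \<le> 1 \<and> (\<forall>n\<le>k. B (x n) (y n) > 1 - \<eta>)"
      then obtain f where f: "f \<in> dual_ball" "form_of f = B"
        using bilinear_form_in_dual_ball[of B] by blast
      obtain g where g: "g \<in> dual_ball" "\<And>n. g (T n) = 1" "\<And>h. f h - g h \<le> \<epsilon> / 2 * norm h"
        using k(2)[OF f(1)] B unfolding f(2)[symmetric] form_T by blast
      have "bilin_norm (form_of (\<lambda>z. f z - g z)) \<le> \<epsilon> / 2"
        using \<epsilon> by (intro bilin_norm_form_of_le linear_compose_sub dual_ball_linear f g) auto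
      then have "bilin_norm (\<lambda>u v. B u v - form_of g u v) < \<epsilon>"
        using \<epsilon> unfolding f(2)[symmetric] by (simp add: form_of_def[abs_def])
      moreover have "bilin_norm (form_of g) = 1"
        using dual_ball_form_of[OF g(1)] unit g(2)
        by (intro bilin_norm_eq_1[of _ "x 0" "y 0"]) (auto simp: form_T)
      ultimately show "\<exists>B'. bounded_bilinear B' \<and> bilin_norm B' = 1 \<and>
            bilin_norm (\<lambda>u v. B u v - B' u v) < \<epsilon> \<and> (\<forall>n. B' (x n) (y n) = 1)"
        using dual_ball_form_of[OF g(1)] g(2) by (intro exI[of _ "form_of g"]) (auto simp: form_T)
    qed
  qed
  have from_form: "?near \<epsilon>" if \<epsilon>: "\<epsilon> > 0" and near: "?near_form \<epsilon>" for \<epsilon>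
  proof -
    obtain k \<eta> where k: "\<eta> > 0" "\<And>B. bounded_bilinear B \<Longrightarrow> bilin_norm B \<le> 1 \<Longrightarrow>
        \<forall>n\<le>k. B (x n) (y n) > 1 - \<eta> \<Longrightarrow> \<exists>B'. bounded_bilinear B' \<and> bilin_norm B' = 1 \<and>
            bilin_norm (\<lambda>u v. B u v - B' u v) < \<epsilon> \<and> (\<forall>n. B' (x n) (y n) = 1)"
      using near by blast
    show ?thesis
    proof (intro exI[of _ k] exI[of _ \<eta>] conjI k(1) ballI impI)
      fix f assume f: "f \<in> dual_ball" "\<forall>n\<le>k. f (T n) > 1 - \<eta>"
      obtain B' where B': "bounded_bilinear B'" "bilin_norm B' = 1"
        "bilin_norm (\<lambda>u v. form_of f u v - B' u v) < \<epsilon>" "\<And>n. B' (x n) (y n) = 1"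
        using k(2)[OF dual_ball_form_of[OF f(1)]] f(2) unfolding form_T by blast
      obtain g where g: "g \<in> dual_ball" "form_of g = B'"
        using bilinear_form_in_dual_ball[OF B'(1)] B'(2) by auto
      have D: "bounded_linear (\<lambda>z. f z - g z)"
        by (intro bounded_linear_sub dual_ball_bounded_linear f g)
      have eq: "form_of (\<lambda>z. f z - g z) = (\<lambda>u v. form_of f u v - B' u v)"
        unfolding g(2)[symmetric] by (simp add: form_of_def[abs_def])
      have "f (u \<otimes>\<^sub>\<pi> v) - g (u \<otimes>\<^sub>\<pi> v) \<le> \<epsilon> * (norm u * norm v)" for u v
        using bilin_norm_bound[OF bounded_bilinear_form_of[OF D], of u v]
          mult_right_mono[OF less_imp_le[OF B'(3)], of "norm u * norm v"]
        unfolding eq[symmetric] by (simp add: form_of_def mult.assoc)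
      then have "f h - g h \<le> \<epsilon> * norm h" for h
        by (intro functional_le_on_pure_tensors[OF D]) (use \<epsilon> in auto)
      then show "\<exists>g\<in>dual_ball. (\<forall>n. g (T n) = 1) \<and> (\<forall>h. f h - g h \<le> \<epsilon> * norm h)"
        using g B'(4) by (intro bexI[of _ g]) (auto simp: form_T[symmetric])
    qed
  qed
  have "(\<forall>\<epsilon>>0. ?near \<epsilon>) \<longleftrightarrow> (\<forall>\<epsilon>>0. ?near_form \<epsilon>)"
  proof (intro iffI allI impI)
    show "?near_form \<epsilon>" if "\<forall>\<epsilon>>0. ?near \<epsilon>" "\<epsilon> > 0" for \<epsilon>
      by (rule to_form[OF that(2)], rule that(1)[rule_format]) (use that(2) in simp)
    show "?near \<epsilon>" if "\<forall>\<epsilon>>0. ?near_form \<epsilon>" "\<epsilon> > 0" for \<epsilon>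
      by (rule from_form[OF that(2)], rule that(1)[rule_format, OF that(2)])
  qed
  then show "(\<forall>\<mu> :: nat \<Rightarrow> real. (\<forall>n. \<mu> n \<in> {0<..1}) \<and> \<mu> sums 1 \<longrightarrow>
            SSD_point (suminf (\<lambda>n. \<mu> n *\<^sub>R (x n \<otimes>\<^sub>\<pi> y n))))
         \<longleftrightarrow> (\<forall>\<epsilon>>0. ?near_form \<epsilon>)"
    using SSD_convex_series_iff[where T = T, OF T g0(1) g0_T] unfolding T_def by (rule trans[rotated])
qed

end
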